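(* The induction schema is not $\mu$-realised: there is a formula $\varphi(x)$ of arithmetic such that the sentence $\big(\varphi(0)\wedge\forall x(\varphi(x)\to\varphi(Sx))\big)\to\forall x\,\varphi(x)$ is not $\mu$-realisable.
   Context: Formulas are in the first-order language of arithmetic ($0,S,+,\cdot,=$; $\neg\varphi$ abbreviates $\varphi\to\bot$). Programs are oracle Turing programs, identified with natural-number codes via a fixed computable enumeration; for a program $p$, oracle $u\in 2^\omega$ and $n\in\mathbb N$, $p^u(n)$ is the output of $p$ on input $n$ with oracle $u$. $\mu$ is the Lebesgue (fair-coin) measure on $2^\omega$. $\mu$-realisability: relations $(p,u)\Vdash_O\varphi$ and $p\Vdash_\mu\varphi$ are defined by simultaneous recursion on the sentence $\varphi$: never $(p,u)\Vdash_O\bot$; $(p,u)\Vdash_O t=s$ iff $t,s$ have the same value in $\mathbb N$; $(p,u)\Vdash_O\varphi\wedge\psi$ iff $(p^u(0),u)\Vdash_O\varphi$ and $(p^u(1),u)\Vdash_O\psi$; $(p,u)\Vdash_O\varphi\vee\psi$ iff $p^u(0)=0$ and $(p^u(1),u)\Vdash_O\varphi$, or $p^u(0)=1$ and $(p^u(1),u)\Vdash_O\psi$; $(p,u)\Vdash_O\varphi\to\psi$ iff for every $s$ with $s\Vdash_\mu\varphi$ we have $p^u(s)\Vdash_\mu\psi$; $(p,u)\Vdash_O\exists x\varphi(x)$ iff $(p^u(0),u)\Vdash_O\varphi(p^u(1))$; $(p,u)\Vdash_O\forall x\varphi(x)$ iff $(p^u(n),u)\Vdash_O\varphi(n)$ for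 all $n$ (outputs mentioned are required to exist). Let $C_{p,\varphi}=\{u:(p,u)\Vdash_O\varphi\}$; $p\Vdash_\mu\varphi$ iff $\mu(C_{p,\varphi})\ge r$ for some real $r>0$. A sentence $\varphi$ is $\mu$-realisable iff $\sup\{\mu(C_{p,\varphi}):p\Vdash_\mu\varphi\}=1$. *)

theory Defs
  imports "HOL-Probability.Probability" "HOL-Library.Nat_Bijection"
begin

section \<open>The language of arithmetic\<close>

datatype arith_term =
  Var nat | Zero | Succ arith_term | Plus arith_term arith_term | Times arith_term arith_term

datatype formula =
    Falsum
  | Equal arith_term arith_term
  | Conj formula formula
  | Disj formula formula
  | Impl formula formula
  | Exists nat formula
  | Forall nat formula

primrec term_vars :: "arith_term \<Rightarrow> nat set" where
  "term_vars (Var x) = {x}"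
| "term_vars Zero = {}"
| "term_vars (Succ t) = term_vars t"
| "term_vars (Plus s t) = term_vars s \<union> term_vars t"
| "term_vars (Times s t) = term_vars s \<union> term_vars t"

primrec free_vars :: "formula \<Rightarrow> nat set" where
  "free_vars Falsum = {}"
| "free_vars (Equal s t) = term_vars s \<union> term_vars t"
| "free_vars (Conj \<phi> \<psi>) = free_vars \<phi> \<union> free_vars \<psi>"
| "free_vars (Disj \<phi> \<psi>) = free_vars \<phi> \<union> free_vars \<psi>"
| "free_vars (Impl \<phi> \<psi>) = free_vars \<phi> \<union> free_vars \<psi>"
| "free_vars (Exists x \<phi>) = free_vars \<phi> - {x}"
| "free_vars (Forall x \<phi>) = free_vars \<phi> - {x}"

primrec subst_term :: "arith_term \<Rightarrow> nat \<Rightarrow> arith_term \<Rightarrow> arith_term" where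
  "subst_term (Var y) x r = (if y = x then r else Var y)"
| "subst_term Zero x r = Zero"
| "subst_term (Succ t) x r = Succ (subst_term t x r)"
| "subst_term (Plus s t) x r = Plus (subst_term s x r) (subst_term t x r)"
| "subst_term (Times s t) x r = Times (subst_term s x r) (subst_term t x r)"

text \<open>
  \<open>subst \<phi> x r\<close> replaces the free occurrences of \<open>x\<close> in \<open>\<phi>\<close> by \<open>r\<close>, without renaming bound
  variables. It is only applied to terms \<open>r\<close> with at most the variable \<open>x\<close> itself, where no
  capture can occur: no free occurrence of \<open>x\<close> lies in the scope of a quantifier on \<open>x\<close>.
\<close>

primrec subst :: "formula \<Rightarrow> nat \<Rightarrow> arith_term \<Rightarrow> formula" where
  "subst Falsum x r = Falsum"
| "subst (Equal s t) x r = Equal (subst_term s x r) (subst_term t x r)"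
| "subst (Conj \<phi> \<psi>) x r = Conj (subst \<phi> x r) (subst \<psi> x r)"
| "subst (Disj \<phi> \<psi>) x r = Disj (subst \<phi> x r) (subst \<psi> x r)"
| "subst (Impl \<phi> \<psi>) x r = Impl (subst \<phi> x r) (subst \<psi> x r)"
| "subst (Exists y \<phi>) x r = Exists y (if y = x then \<phi> else subst \<phi> x r)"
| "subst (Forall y \<phi>) x r = Forall y (if y = x then \<phi> else subst \<phi> x r)"

primrec numeral_term :: "nat \<Rightarrow> arith_term" where
  "numeral_term 0 = Zero"
| "numeral_term (Suc n) = Succ (numeral_term n)"

text \<open>Only the values of closed terms matter; variables get a dummy value.\<close>

primrec term_value :: "arith_term \<Rightarrow> nat" where
  "term_value (Var x) = 0"
| "term_value Zero = 0"
| "term_value (Succ t) = Suc (term_value t)"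
| "term_value (Plus s t) = term_value s + term_value t"
| "term_value (Times s t) = term_value s * term_value t"

definition induction_sentence :: "nat \<Rightarrow> formula \<Rightarrow> formula" where
  "induction_sentence x \<phi> =
     Impl (Conj (subst \<phi> x Zero) (Forall x (Impl \<phi> (subst \<phi> x (Succ (Var x))))))
          (Forall x \<phi>)"

lemma term_vars_subst_subset:
  "term_vars (subst_term t x r) \<subseteq> (term_vars t - {x}) \<union> term_vars r"
  by (induction t) auto

lemma free_vars_subst_subset:
  "free_vars (subst \<phi> x r) \<subseteq> (free_vars \<phi> - {x}) \<union> term_vars r"
proof (induction \<phi>)
  case (Equal s t)
  show ?case using term_vars_subst_subset[of s x r] term_vars_subst_subset[of t x r] by auto
qed auto

lemma induction_sentence_closed:
  "free_vars \<phi> \<subseteq> {x} \<Longrightarrow> free_vars (induction_sentence x \<phi>) = {}"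
  using free_vars_subst_subset[of \<phi> x Zero] free_vars_subst_subset[of \<phi> x "Succ (Var x)"]
  by (auto simp: induction_sentence_def)


section \<open>Oracle Turing programs\<close>

text \<open>
  A machine has a read-only one-way infinite oracle tape carrying \<open>u\<close>, a two-way infinite work
  tape over the alphabet consisting of the blank (\<open>False\<close>) and the mark (\<open>True\<close>), and one head on
  each tape. A program is a finite transition table that maps a state, the scanned oracle bit
  and the scanned work symbol to a new state, the symbol to be written, a move of the work
  head and a move of the oracle head. If several entries have the same key, the first one counts.
\<close>

type_synonym bit_sequence = "nat \<Rightarrow> bool"

datatype move = MoveLeft | Stay | MoveRight

type_synonym program = "((nat \<times> bool \<times> bool) \<times> (nat \<times> bool \<times> move \<times> move)) list"

text \<open>
  A configuration \<open>(q, i, l, r)\<close> consists of the state, the position of the oracle head, the part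
  of the work tape to the left of the work head (nearest cell first), and the part that starts at
  the scanned cell. All cells beyond the ends of the two lists are blank.
\<close>

type_synonym config = "nat \<times> nat \<times> bool list \<times> bool list"

fun scanned :: "bool list \<Rightarrow> bool" where
  "scanned [] = False"
| "scanned (b # bs) = b"

fun move_work :: "move \<Rightarrow> bool list \<times> bool list \<Rightarrow> bool list \<times> bool list" where
  "move_work MoveLeft (l, r) = (tl l, scanned l # r)"
| "move_work Stay (l, r) = (l, r)"
| "move_work MoveRight (l, r) = (scanned r # l, tl r)"

fun move_oracle :: "move \<Rightarrow> nat \<Rightarrow> nat" where
  "move_oracle MoveLeft i = i - 1"
| "move_oracle Stay i = i"
| "move_oracle MoveRight i = i + 1"

fun step :: "program \<Rightarrow> bit_sequence \<Rightarrow> config \<Rightarrow> config option" where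
  "step P u (q, i, l, r) =
     (case map_of P (q, u i, scanned r) of
        None \<Rightarrow> None
      | Some (q', b, mw, mo) \<Rightarrow> Some (q', move_oracle mo i, move_work mw (l, b # tl r)))"

text \<open>
  The input \<open>n\<close> is presented as a block of \<open>n + 1\<close> marks, the output is the number of marks on the
  work tape when no transition applies any more.
\<close>

definition initial_config :: "nat \<Rightarrow> config" where
  "initial_config n = (0, 0, [], replicate (Suc n) True)"

fun output_of :: "config \<Rightarrow> nat" where
  "output_of (q, i, l, r) = count_list l True + count_list r True"

fun move_of_nat :: "nat \<Rightarrow> move" where
  "move_of_nat k = (if k = 0 then MoveLeft else if k = 1 then Stay else MoveRight)"

text \<open>
  For each pair of states \<open>q\<close>, \<open>q'\<close> there are \<open>2 * 2 * 2 * 3 * 3 = 72\<close> table entries, which are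
  numbered by the remainder of the code modulo 72.
\<close>

definition entry_of_nat ::
    "nat \<Rightarrow> (nat \<times> bool \<times> bool) \<times> (nat \<times> bool \<times> move \<times> move)" where
  "entry_of_nat n =
     (let (q, q') = prod_decode (n div 72); k = n mod 72
      in ((q, odd k, odd (k div 2)),
          (q', odd (k div 4), move_of_nat (k div 8 mod 3), move_of_nat (k div 24))))"

definition program_of :: "nat \<Rightarrow> program" where
  "program_of p = map entry_of_nat (list_decode p)"

text \<open>\<open>computes p u n m\<close> means that \<open>p^u(n)\<close> is defined and equal to \<open>m\<close>.\<close>

definition computes :: "nat \<Rightarrow> bit_sequence \<Rightarrow> nat \<Rightarrow> nat \<Rightarrow> bool" where
  "computes p u n m \<longleftrightarrow>
     (\<exists>c. (\<lambda>c d. step (program_of p) u c = Some d)\<^sup>*\<^sup>* (initial_config n) c \<and>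
          step (program_of p) u c = None \<and> output_of c = m)"

lemma computes_unique:
  assumes "computes p u n m" "computes p u n m'"
  shows "m = m'"
proof -
  let ?R = "\<lambda>c d. step (program_of p) u c = Some d"
  have final: "d = c" if "?R\<^sup>*\<^sup>* c d" "step (program_of p) u c = None" for c d
    using that by (auto elim: converse_rtranclpE)
  have "c = d" if "?R\<^sup>*\<^sup>* a c" "?R\<^sup>*\<^sup>* a d"
      "step (program_of p) u c = None" "step (program_of p) u d = None" for a c d
    using that
  proof (induction rule: converse_rtranclp_induct)
    case base
    then show ?case using final by blast
  next
    case (step y z)
    from step.prems(1) show ?case
    proof (cases rule: converse_rtranclpE)
      case base
      then show ?thesis using step by simp
    next
      case (step z')
      then show ?thesis using \<open>?R y z\<close> step.prems step.IH by simp
    qed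
  qed
  then show ?thesis
    using assms unfolding computes_def by blast
qed

lemma surj_entry_of_nat: "surj entry_of_nat"
proof -
  have surj_move: "\<exists>k \<in> {0, 1, 2}. move_of_nat k = w" for w
    by (cases w) auto
  have "\<exists>n. e = entry_of_nat n" for e
  proof -
    obtain q a b q' c v w where e: "e = ((q, a, b), (q', c, v, w))" by (cases e) auto
    obtain i j where ij: "i \<in> {0, 1, 2}" "j \<in> {0, 1, 2}"
        and vw: "v = move_of_nat i" "w = move_of_nat j"
      using surj_move[of v] surj_move[of w] by blast
    define k where
      "k = of_bool a + 2 * of_bool b + 4 * of_bool c + 8 * i + (24 * j :: nat)"
    have k: "k < 72" "odd k = a" "odd (k div 2) = b" "odd (k div 4) = c"
        "k div 8 mod 3 = i" "k div 24 = j"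
      using ij unfolding k_def by (cases a; cases b; cases c; auto)+
    have "(72 * prod_encode (q, q') + k) div 72 = prod_encode (q, q')"
        "(72 * prod_encode (q, q') + k) mod 72 = k"
      using k(1) by simp_all
    then have "e = entry_of_nat (72 * prod_encode (q, q') + k)"
      unfolding entry_of_nat_def e by (simp only: k vw prod_encode_inverse Let_def case_prod_conv)
    then show ?thesis ..
  qed
  then show ?thesis by (simp add: surj_def)
qed

lemma surj_program_of: "surj program_of"
proof -
  have "\<exists>p. P = program_of p" for P
  proof -
    have "\<exists>ns. P = map entry_of_nat ns"
      using surj_entry_of_nat unfolding ex_map_conv surj_def by blast
    then obtain ns where "P = map entry_of_nat ns" ..
    then have "P = program_of (list_encode ns)"
      by (simp add: program_of_def)
    then show ?thesis ..
  qed
  then show ?thesis by (simp add: surj_def)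
qed


section \<open>Realisability\<close>

definition coin_measure :: "bit_sequence measure" where
  "coin_measure = PiM UNIV (\<lambda>_. measure_pmf (bernoulli_pmf (1/2)))"

primrec connectives :: "formula \<Rightarrow> nat" where
  "connectives Falsum = 0"
| "connectives (Equal s t) = 0"
| "connectives (Conj \<phi> \<psi>) = Suc (connectives \<phi> + connectives \<psi>)"
| "connectives (Disj \<phi> \<psi>) = Suc (connectives \<phi> + connectives \<psi>)"
| "connectives (Impl \<phi> \<psi>) = Suc (connectives \<phi> + connectives \<psi>)"
| "connectives (Exists x \<phi>) = Suc (connectives \<phi>)"
| "connectives (Forall x \<phi>) = Suc (connectives \<phi>)"

lemma connectives_subst [simp]: "connectives (subst \<phi> x r) = connectives \<phi>"
  by (induction \<phi>) auto

function O_realises :: "formula \<Rightarrow> nat \<Rightarrow> bit_sequence \<Rightarrow> bool"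
    and mu_realises :: "formula \<Rightarrow> nat \<Rightarrow> bool" where
  "O_realises Falsum p u \<longleftrightarrow> False"
| "O_realises (Equal s t) p u \<longleftrightarrow> term_value s = term_value t"
| "O_realises (Conj \<phi> \<psi>) p u \<longleftrightarrow>
     (\<exists>a b. computes p u 0 a \<and> O_realises \<phi> a u \<and> computes p u 1 b \<and> O_realises \<psi> b u)"
| "O_realises (Disj \<phi> \<psi>) p u \<longleftrightarrow>
     (computes p u 0 0 \<and> (\<exists>a. computes p u 1 a \<and> O_realises \<phi> a u)) \<or>
     (computes p u 0 1 \<and> (\<exists>b. computes p u 1 b \<and> O_realises \<psi> b u))"
| "O_realises (Impl \<phi> \<psi>) p u \<longleftrightarrow>
     (\<forall>s. mu_realises \<phi> s \<longrightarrow> (\<exists>a. computes p u s a \<and> mu_realises \<psi> a))"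
| "O_realises (Exists x \<phi>) p u \<longleftrightarrow>
     (\<exists>a n. computes p u 0 a \<and> computes p u 1 n \<and> O_realises (subst \<phi> x (numeral_term n)) a u)"
| "O_realises (Forall x \<phi>) p u \<longleftrightarrow>
     (\<forall>n. \<exists>a. computes p u n a \<and> O_realises (subst \<phi> x (numeral_term n)) a u)"
| "mu_realises \<phi> p \<longleftrightarrow>
     (\<exists>r::real. 0 < r \<and> ennreal r \<le> emeasure coin_measure {u. O_realises \<phi> p u})"
  by pat_completeness auto
termination
  by (relation "Wellfounded.measure (case_sum (\<lambda>(\<phi>, p, u). 2 * connectives \<phi>)
                                              (\<lambda>(\<phi>, p). Suc (2 * connectives \<phi>)))") auto

text \<open>
  The supremum is taken in \<^typ>\<open>ennreal\<close>, so it is \<open>0\<close> if no program realises the sentence.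
\<close>

definition mu_realisable :: "formula \<Rightarrow> bool" where
  "mu_realisable \<phi> \<longleftrightarrow>
     (SUP p \<in> {p. mu_realises \<phi> p}. emeasure coin_measure {u. O_realises \<phi> p u}) = 1"

text \<open>
  All realisability sets are measurable, so that the convention that \<open>emeasure\<close> vanishes on
  nonmeasurable sets, and the distinction between the fair-coin measure and its completion, are
  irrelevant here.
\<close>

lemma space_coin_measure [simp]: "space coin_measure = UNIV"
  by (auto simp: coin_measure_def space_PiM)

lemma pred_coin_component: "Measurable.pred coin_measure (\<lambda>u. Q (u i))"
proof -
  have "(\<lambda>u. u i) \<in> measurable coin_measure (measure_pmf (bernoulli_pmf (1/2)))"
    unfolding coin_measure_def by (rule measurable_component_singleton) simp
  then have "(\<lambda>u. u i) \<in> measurable coin_measure (count_space UNIV)"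
    by simp
  then show ?thesis
    by (rule measurable_compose) simp
qed

lemma pred_step: "Measurable.pred coin_measure (\<lambda>u. step P u c = d)"
proof -
  obtain q i l r where "c = (q, i, l, r)" by (metis prod_cases4)
  then show ?thesis
    using pred_coin_component[of "\<lambda>b. (case map_of P (q, b, scanned r) of
        None \<Rightarrow> None
      | Some (q', b, mw, mo) \<Rightarrow> Some (q', move_oracle mo i, move_work mw (l, b # tl r))) = d" i]
    by simp
qed

lemma pred_computes: "Measurable.pred coin_measure (\<lambda>u. computes p u n m)"
proof -
  have "Measurable.pred coin_measure (\<lambda>u. ((\<lambda>c d. step P u c = Some d) ^^ k) c d)" for P k c d
  proof (induction k arbitrary: d)
    case (Suc k)
    note Suc [measurable] and pred_step [measurable]
    show ?case unfolding relpowp.simps relcompp_apply by measurable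
  qed simp
  note this [measurable] and pred_step [measurable]
  show ?thesis
    unfolding computes_def rtranclp_power by measurable
qed

lemma pred_O_realises: "Measurable.pred coin_measure (\<lambda>u. O_realises \<phi> p u)"
proof (induction "connectives \<phi>" arbitrary: \<phi> p rule: less_induct)
  case less
  note pred_computes [measurable]
  show ?case
  proof (cases \<phi>)
    case (Conj \<alpha> \<beta>)
    have [measurable]: "Measurable.pred coin_measure (\<lambda>u. O_realises \<alpha> a u)"
        "Measurable.pred coin_measure (\<lambda>u. O_realises \<beta> a u)" for a
      using less Conj by auto
    show ?thesis unfolding Conj O_realises.simps by measurable
  next
    case (Disj \<alpha> \<beta>)
    have [measurable]: "Measurable.pred coin_measure (\<lambda>u. O_realises \<alpha> a u)"
        "Measurable.pred coin_measure (\<lambda>u. O_realises \<beta> a u)" for a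
      using less Disj by auto
    show ?thesis unfolding Disj O_realises.simps by measurable
  next
    case (Exists x \<alpha>)
    have [measurable]:
        "Measurable.pred coin_measure (\<lambda>u. O_realises (subst \<alpha> x (numeral_term n)) a u)" for a n
      using less Exists by auto
    show ?thesis unfolding Exists O_realises.simps by measurable
  next
    case (Forall x \<alpha>)
    have [measurable]:
        "Measurable.pred coin_measure (\<lambda>u. O_realises (subst \<alpha> x (numeral_term n)) a u)" for a n
      using less Forall by auto
    show ?thesis unfolding Forall O_realises.simps by measurable
  next
    case (Impl \<alpha> \<beta>)
    show ?thesis unfolding Impl O_realises.simps by measurable
  next
    case (Equal s t)
    show ?thesis unfolding Equal O_realises.simps by measurable
  next
    case Falsum
    show ?thesis unfolding Falsum O_realises.simps by measurable
  qed
qed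

lemma realisers_measurable: "{u. O_realises \<phi> p u} \<in> sets coin_measure"
  using pred_O_realises[of \<phi> p] by (simp add: pred_def)

end

theory Submission
  imports Defs
begin

text \<open>
  The formula is \<open>\<phi>(x) = \<exists>y. P(x, y)\<close>, where \<open>P(n, y)\<close> says that for every program \<open>p \<le> n\<close> the
  probability that \<open>p\<close>, as a realiser of the generalisation, returns at \<open>n\<close> a witness of size at
  least \<open>y\<close> is at most \<open>2 ^ - n\<close>. Writing this probability as the limit of the proportions of oracles of
  length \<open>k\<close> that give such an answer within \<open>k\<close> steps shows that \<open>P\<close> is arithmetical, and \<open>P\<close> can be
  expressed by a formula whose realisers carry no information. Since \<open>P\<close> is upward closed
  in \<open>y\<close>, guessing the number of leading ones of the oracle realises every \<open>\<phi>(n)\<close> with positive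
  probability, and a constant function turns any realiser of \<open>\<phi>(n)\<close> into this one. A realiser \<open>a\<close> of
  \<open>\<forall>x. \<phi>(x)\<close>, however, succeeds at every \<open>n \<ge> a\<close> with probability at most \<open>2 ^ - n\<close>, hence
  almost never.
\<close>

section \<open>Formulas whose realisers carry no information\<close>

abbreviation Neg :: "formula \<Rightarrow> formula" where
  "Neg \<phi> \<equiv> Impl \<phi> Falsum"

section \<open>Truth in the standard model\<close>

primrec eval_term :: "arith_term \<Rightarrow> (nat \<Rightarrow> nat) \<Rightarrow> nat" where
  "eval_term (Var x) v = v x"
| "eval_term Zero v = 0"
| "eval_term (Succ t) v = Suc (eval_term t v)"
| "eval_term (Plus s t) v = eval_term s v + eval_term t v"
| "eval_term (Times s t) v = eval_term s v * eval_term t v"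

primrec sat :: "formula \<Rightarrow> (nat \<Rightarrow> nat) \<Rightarrow> bool" where
  "sat Falsum v \<longleftrightarrow> False"
| "sat (Equal s t) v \<longleftrightarrow> eval_term s v = eval_term t v"
| "sat (Conj \<phi> \<psi>) v \<longleftrightarrow> sat \<phi> v \<and> sat \<psi> v"
| "sat (Disj \<phi> \<psi>) v \<longleftrightarrow> sat \<phi> v \<or> sat \<psi> v"
| "sat (Impl \<phi> \<psi>) v \<longleftrightarrow> (sat \<phi> v \<longrightarrow> sat \<psi> v)"
| "sat (Exists x \<phi>) v \<longleftrightarrow> (\<exists>n. sat \<phi> (v(x := n)))"
| "sat (Forall x \<phi>) v \<longleftrightarrow> (\<forall>n. sat \<phi> (v(x := n)))"

lemma eval_term_cong: "(\<And>x. x \<in> term_vars t \<Longrightarrow> v x = w x) \<Longrightarrow> eval_term t v = eval_term t w"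
  by (induction t) auto

lemma sat_cong: "(\<And>x. x \<in> free_vars \<phi> \<Longrightarrow> v x = w x) \<Longrightarrow> sat \<phi> v \<longleftrightarrow> sat \<phi> w"
proof (induction \<phi> arbitrary: v w)
  case (Equal s t)
  have "eval_term s v = eval_term s w" "eval_term t v = eval_term t w"
    using Equal.prems by (intro eval_term_cong; simp)+
  then show ?case by simp
next
  case (Conj \<phi> \<psi>)
  have "sat \<phi> v \<longleftrightarrow> sat \<phi> w" "sat \<psi> v \<longleftrightarrow> sat \<psi> w"
    using Conj.prems by (intro Conj.IH; simp)+
  then show ?case by simp
next
  case (Disj \<phi> \<psi>)
  have "sat \<phi> v \<longleftrightarrow> sat \<phi> w" "sat \<psi> v \<longleftrightarrow> sat \<psi> w"
    using Disj.prems by (intro Disj.IH; simp)+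
  then show ?case by simp
next
  case (Impl \<phi> \<psi>)
  have "sat \<phi> v \<longleftrightarrow> sat \<phi> w" "sat \<psi> v \<longleftrightarrow> sat \<psi> w"
    using Impl.prems by (intro Impl.IH; simp)+
  then show ?case by simp
next
  case (Exists x \<phi>)
  have "sat \<phi> (v(x := n)) \<longleftrightarrow> sat \<phi> (w(x := n))" for n
    using Exists.prems by (intro Exists.IH) auto
  then show ?case by simp
next
  case (Forall x \<phi>)
  have "sat \<phi> (v(x := n)) \<longleftrightarrow> sat \<phi> (w(x := n))" for n
    using Forall.prems by (intro Forall.IH) auto
  then show ?case by simp
qed simp

lemma eval_numeral_term [simp]: "eval_term (numeral_term n) v = n"
  by (induction n) auto

lemma term_vars_numeral_term [simp]: "term_vars (numeral_term n) = {}"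
  by (induction n) auto

lemma eval_subst_term: "eval_term (subst_term t x r) v = eval_term t (v(x := eval_term r v))"
  by (induction t) auto

text \<open>Numerals are closed, so substitution without renaming cannot capture a variable.\<close>

lemma sat_subst_numeral: "sat (subst \<phi> x (numeral_term n)) v \<longleftrightarrow> sat \<phi> (v(x := n))"
proof (induction \<phi> arbitrary: v)
  case (Exists y \<phi>)
  have "v(y := m, x := n) = v(x := n, y := m)" if "y \<noteq> x" for m
    using that by (rule fun_upd_twist)
  then show ?case by (cases "y = x") (simp_all add: Exists del: fun_upd_apply)
next
  case (Forall y \<phi>)
  have "v(y := m, x := n) = v(x := n, y := m)" if "y \<noteq> x" for m
    using that by (rule fun_upd_twist)
  then show ?case by (cases "y = x") (simp_all add: Forall del: fun_upd_apply)
qed (simp_all add: eval_subst_term del: fun_upd_apply)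

text \<open>The dummy value of variables is 0, so realisability of equations is truth under the zero
  valuation. This is why that valuation appears in \<open>O_realises_inert\<close>.\<close>

lemma term_value_conv_eval: "term_value t = eval_term t (\<lambda>_. 0)"
  by (induction t) auto

text \<open>Conjunction and generalisation are allowed only directly under a negation, since a
  negation has either all realisers or none. Classically these connectives still express every
  arithmetical relation.\<close>

inductive inert :: "formula \<Rightarrow> bool" where
  inert_Equal: "inert (Equal s t)"
| inert_nand: "inert \<phi> \<Longrightarrow> inert \<psi> \<Longrightarrow> inert (Neg (Conj \<phi> \<psi>))"
| inert_nall: "inert \<phi> \<Longrightarrow> inert (Neg (Forall x \<phi>))"

lemma inert_subst: "inert \<phi> \<Longrightarrow> inert (subst \<phi> x r)"
  by (induction rule: inert.induct) (auto intro: inert.intros)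

lemma count_list_replicate: "count_list (replicate n x) x = n"
  by (induction n) auto

text \<open>The code 0 decodes to the empty table: the machine halts at once, with the
  \<open>n + 1\<close> marks of the input still on the tape.\<close>

lemma computes_0: "computes 0 u n (Suc n)"
  unfolding computes_def program_of_def
  by (intro exI[of _ "initial_config n"] conjI rtranclp.rtrancl_refl)
    (simp_all add: initial_config_def count_list_replicate del: replicate_Suc)

lemma prob_space_coin: "prob_space coin_measure"
  unfolding coin_measure_def by (intro prob_space_PiM measure_pmf.prob_space_axioms)

declare mu_realises.simps [simp del]

lemma mu_realises_imp_O_realises: "mu_realises \<phi> p \<Longrightarrow> \<exists>u. O_realises \<phi> p u"
proof (rule ccontr)
  assume *: "mu_realises \<phi> p" "\<nexists>u. O_realises \<phi> p u"
  then have "{u. O_realises \<phi> p u} = {}" by blast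
  with *(1) obtain r where "0 < r" "ennreal r \<le> 0" unfolding mu_realises.simps by auto
  then show False by (simp add: ennreal_eq_0_iff)
qed

lemma mu_realises_if_all:
  assumes "\<And>u. O_realises \<phi> p u" shows "mu_realises \<phi> p"
proof -
  have "{u. O_realises \<phi> p u} = space coin_measure" using assms by simp
  then have "emeasure coin_measure {u. O_realises \<phi> p u} = 1"
    using prob_space.emeasure_space_1[OF prob_space_coin] by metis
  then show ?thesis unfolding mu_realises.simps by (intro exI[of _ 1]) simp
qed

text \<open>As \<open>Falsum\<close> has no realiser, the implication can only hold vacuously.
  Neither the program nor the oracle matters any more.\<close>

lemma O_realises_Neg: "O_realises (Neg \<phi>) p u \<longleftrightarrow> (\<forall>s. \<not> mu_realises \<phi> s)"
  using mu_realises_imp_O_realises[of Falsum] by auto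

text \<open>
  Because realisers of a inert formula carry no information, the program \<open>0\<close>, which is total,
  realises conjunctions and generalisations of true inert formulas.
\<close>

lemma O_realises_inert: "inert \<phi> \<Longrightarrow> O_realises \<phi> p u \<longleftrightarrow> sat \<phi> (\<lambda>_. 0)"
\<comment> \<open>The quantifier case needs the hypothesis for numeral instances of the body. These
  are not subformulas, but substitution preserves the number of connectives.\<close>
proof (induction "connectives \<phi>" arbitrary: \<phi> p u rule: less_induct)
  case less
  from less.prems show ?case
  proof cases
    case (inert_Equal s t)
    then show ?thesis by (simp add: term_value_conv_eval)
  next
    case (inert_nand \<alpha> \<beta>)
    have IH: "O_realises \<alpha> p u \<longleftrightarrow> sat \<alpha> (\<lambda>_. 0)" "O_realises \<beta> p u \<longleftrightarrow> sat \<beta> (\<lambda>_. 0)" for p u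
      using less.hyps inert_nand by auto
    have "mu_realises (Conj \<alpha> \<beta>) 0" if "sat (Conj \<alpha> \<beta>) (\<lambda>_. 0)"
      using that computes_0 by (intro mu_realises_if_all) (auto simp: IH)
    moreover have "sat (Conj \<alpha> \<beta>) (\<lambda>_. 0)" if "mu_realises (Conj \<alpha> \<beta>) s" for s
      using mu_realises_imp_O_realises[OF that] by (auto simp: IH)
    ultimately show ?thesis
      unfolding inert_nand O_realises_Neg by auto
  next
    case (inert_nall \<alpha> x)
    have IH: "O_realises (subst \<alpha> x (numeral_term n)) p u \<longleftrightarrow> sat \<alpha> ((\<lambda>_. 0)(x := n))" for p u n
      using less.hyps inert_nall inert_subst by (auto simp: sat_subst_numeral)
    have "mu_realises (Forall x \<alpha>) 0" if "sat (Forall x \<alpha>) (\<lambda>_. 0)"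
      using that computes_0 by (intro mu_realises_if_all) (auto simp: IH)
    moreover have "sat (Forall x \<alpha>) (\<lambda>_. 0)" if "mu_realises (Forall x \<alpha>) s" for s
      using mu_realises_imp_O_realises[OF that] by (auto simp: IH)
    ultimately show ?thesis
      unfolding inert_nall O_realises_Neg by auto
  qed
qed

text \<open>
  The level \<open>d\<close> bounds the free variables, so that the variable \<open>d\<close> is fresh. The rules for binders
  below are in higher-order style: a bound variable is replaced by an arbitrary arithmetical
  expression of a level \<open>d' \<ge> d\<close>, which makes side conditions on variables unnecessary.
\<close>

definition arith_rel :: "nat \<Rightarrow> ((nat \<Rightarrow> nat) \<Rightarrow> bool) \<Rightarrow> bool" where
  "arith_rel d P \<longleftrightarrow> (\<exists>\<phi>. inert \<phi> \<and> free_vars \<phi> \<subseteq> {..<d} \<and> (\<forall>v. sat \<phi> v \<longleftrightarrow> P v))"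

text \<open>The graph is required at every \<open>i \<ge> d\<close> so that the notion survives
  raising the level. The second conjunct excludes expressions such as
  \<open>\<lambda>v. v d\<close>, which satisfies the first one.\<close>

definition arith_fun :: "nat \<Rightarrow> ((nat \<Rightarrow> nat) \<Rightarrow> nat) \<Rightarrow> bool" where
  "arith_fun d e \<longleftrightarrow> (\<forall>i\<ge>d. arith_rel (Suc i) (\<lambda>v. v i = e v)) \<and>
     (\<forall>v w. (\<forall>j<d. v j = w j) \<longrightarrow> e v = e w)"

section \<open>Closure properties of arithmetical relations and functions\<close>

lemma arith_relI:
  "inert \<phi> \<Longrightarrow> free_vars \<phi> \<subseteq> {..<d} \<Longrightarrow> (\<And>v. sat \<phi> v \<longleftrightarrow> P v) \<Longrightarrow> arith_rel d P"
  unfolding arith_rel_def by blast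

lemma arith_rel_cong: "arith_rel d P \<Longrightarrow> (\<And>j. j < d \<Longrightarrow> v j = w j) \<Longrightarrow> P v \<longleftrightarrow> P w"
  unfolding arith_rel_def using sat_cong[of _ v w] by blast

lemma arith_rel_mono:
  assumes "arith_rel d P" "d \<le> d'" shows "arith_rel d' P"
proof -
  obtain \<phi> where "inert \<phi>" "free_vars \<phi> \<subseteq> {..<d}" "\<And>v. sat \<phi> v \<longleftrightarrow> P v"
    using assms(1) unfolding arith_rel_def by blast
  moreover have "{..<d} \<subseteq> {..<d'}" using assms(2) by auto
  ultimately show ?thesis by (intro arith_relI[of \<phi>]) auto
qed

lemma arith_fun_cong: "arith_fun d e \<Longrightarrow> \<forall>j<d. v j = w j \<Longrightarrow> e v = e w"
  unfolding arith_fun_def by blast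

lemma arith_fun_mono:
  assumes "arith_fun d e" "d \<le> d'" shows "arith_fun d' e"
  unfolding arith_fun_def
proof (intro conjI allI impI)
  show "arith_rel (Suc i) (\<lambda>v. v i = e v)" if "d' \<le> i" for i
    using assms that unfolding arith_fun_def by simp
  show "e v = e w" if "\<forall>j<d'. v j = w j" for v w
    using arith_fun_cong[OF assms(1)] assms(2) that by simp
qed

lemma arith_fun_graph: "arith_fun d e \<Longrightarrow> d \<le> i \<Longrightarrow> arith_rel (Suc i) (\<lambda>v. v i = e v)"
  unfolding arith_fun_def by blast

lemma arith_fun_upd: "arith_fun d e \<Longrightarrow> d \<le> i \<Longrightarrow> e (v(i := y)) = e v"
  by (erule arith_fun_cong) simp

lemma arith_rel_nand:
  assumes "arith_rel d P" "arith_rel d Q" shows "arith_rel d (\<lambda>v. \<not> (P v \<and> Q v))"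
proof -
  obtain \<phi> \<psi> where "inert \<phi>" "free_vars \<phi> \<subseteq> {..<d}" "\<forall>v. sat \<phi> v \<longleftrightarrow> P v"
    "inert \<psi>" "free_vars \<psi> \<subseteq> {..<d}" "\<forall>v. sat \<psi> v \<longleftrightarrow> Q v"
    using assms unfolding arith_rel_def by blast
  then show ?thesis
    by (intro arith_relI[of "Neg (Conj \<phi> \<psi>)"]) (auto intro: inert.intros)
qed

lemma arith_rel_nall:
  assumes "arith_rel (Suc d) P" shows "arith_rel d (\<lambda>v. \<not> (\<forall>y. P (v(d := y))))"
proof -
  obtain \<phi> where "inert \<phi>" "free_vars \<phi> \<subseteq> {..<Suc d}" "\<forall>v. sat \<phi> v \<longleftrightarrow> P v"
    using assms unfolding arith_rel_def by blast
  then show ?thesis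
    by (intro arith_relI[of "Neg (Forall d \<phi>)"]) (auto intro: inert.intros simp: less_Suc_eq)
qed

lemma arith_rel_not:
  assumes "arith_rel d P" shows "arith_rel d (\<lambda>v. \<not> P v)"
proof -
  have "arith_rel d (\<lambda>v. \<not> (P v \<and> P v))"
    by (intro arith_rel_nand assms)
  then show ?thesis by (simp only: not_not de_Morgan_conj de_Morgan_disj conj_absorb imp_conv_disj)
qed

lemma arith_rel_conj:
  assumes "arith_rel d P" "arith_rel d Q" shows "arith_rel d (\<lambda>v. P v \<and> Q v)"
proof -
  have "arith_rel d (\<lambda>v. \<not> \<not> (P v \<and> Q v))"
    by (intro arith_rel_not arith_rel_nand assms)
  then show ?thesis by (simp only: not_not de_Morgan_conj de_Morgan_disj conj_absorb imp_conv_disj)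
qed

lemma arith_rel_disj:
  assumes "arith_rel d P" "arith_rel d Q" shows "arith_rel d (\<lambda>v. P v \<or> Q v)"
proof -
  have "arith_rel d (\<lambda>v. \<not> (\<not> P v \<and> \<not> Q v))"
    by (intro arith_rel_nand arith_rel_not assms)
  then show ?thesis by (simp only: not_not de_Morgan_conj de_Morgan_disj conj_absorb imp_conv_disj)
qed

lemma arith_rel_imp:
  assumes "arith_rel d P" "arith_rel d Q" shows "arith_rel d (\<lambda>v. P v \<longrightarrow> Q v)"
proof -
  have "arith_rel d (\<lambda>v. \<not> P v \<or> Q v)"
    by (intro arith_rel_disj arith_rel_not assms)
  then show ?thesis by (simp only: not_not de_Morgan_conj de_Morgan_disj conj_absorb imp_conv_disj)
qed

lemma arith_rel_ex_upd:
  assumes "arith_rel (Suc d) P" shows "arith_rel d (\<lambda>v. \<exists>y. P (v(d := y)))"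
  using arith_rel_nall[OF arith_rel_not[OF assms]] by simp

text \<open>Nothing is substituted syntactically: \<open>P\<close> at \<open>e v\<close> means that
  some \<open>y\<close> with \<open>y = e v\<close> satisfies \<open>P\<close>, and the graph of
  \<open>e\<close> is arithmetical.\<close>

lemma arith_rel_subst:
  assumes "arith_rel (Suc d) P" "arith_fun d e"
  shows "arith_rel d (\<lambda>v. P (v(d := e v)))"
  using arith_rel_ex_upd[OF arith_rel_conj[OF arith_fun_graph[OF assms(2) order_refl] assms(1)]]
    arith_fun_upd[OF assms(2) order_refl] by simp

lemma arith_fun_var:
  assumes "i < d" shows "arith_fun d (\<lambda>v. v i)"
proof -
  have "arith_rel (Suc j) (\<lambda>v. v j = v i)" if "d \<le> j" for j
    using that assms by (intro arith_relI[OF inert_Equal[of "Var j" "Var i"]]) auto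
  then show ?thesis using assms unfolding arith_fun_def by blast
qed

lemma arith_fun_const: "arith_fun d (\<lambda>v. n)"
proof -
  have "arith_rel (Suc j) (\<lambda>v. v j = n)" for j
    by (intro arith_relI[OF inert_Equal[of "Var j" "numeral_term n"]]) auto
  then show ?thesis unfolding arith_fun_def by blast
qed

lemma arith_rel_ex:
  assumes "\<And>d' e. d \<le> d' \<Longrightarrow> arith_fun d' e \<Longrightarrow> arith_rel d' (\<lambda>v. Q v (e v))"
  shows "arith_rel d (\<lambda>v. \<exists>y. Q v y)"
proof -
  \<comment> \<open>Instantiating the bound expression with the constant \<open>y\<close> shows that
    \<open>Q v y\<close> depends only on the variables below \<open>d\<close>. Instantiating it with
    the variable \<open>d\<close> below supplies the matrix to be quantified.\<close>
  have "Q (v(d := y)) y = Q v y" for v y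
    using arith_rel_cong[OF assms[OF order_refl arith_fun_const[of _ y]], of "v(d := y)" v] by simp
  then show ?thesis
    using arith_rel_ex_upd[OF assms[OF _ arith_fun_var[of d "Suc d"]]] by simp
qed

lemma arith_rel_all:
  assumes "\<And>d' e. d \<le> d' \<Longrightarrow> arith_fun d' e \<Longrightarrow> arith_rel d' (\<lambda>v. Q v (e v))"
  shows "arith_rel d (\<lambda>v. \<forall>y. Q v y)"
proof -
  have "arith_rel d (\<lambda>v. \<not> (\<exists>y. \<not> Q v y))"
    by (intro arith_rel_not arith_rel_ex assms)
  then show ?thesis by simp
qed

lemma arith_rel_eq:
  assumes "arith_fun d e" "arith_fun d e'" shows "arith_rel d (\<lambda>v. e v = e' v)"
  using arith_rel_subst[OF arith_fun_graph[OF assms(2) order_refl] assms(1)]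
    arith_fun_upd[OF assms(2) order_refl] by simp

text \<open>With this rule a function is treated through a relation that characterises its value.
  Division, projections and iteration are all obtained in this way.\<close>

lemma arith_funI:
  assumes "\<And>d' e'. d \<le> d' \<Longrightarrow> arith_fun d' e' \<Longrightarrow> arith_rel d' (\<lambda>v. e' v = e v)"
  shows "arith_fun d e"
  unfolding arith_fun_def
proof (intro conjI allI impI)
  fix v w :: "nat \<Rightarrow> nat" assume "\<forall>j<d. v j = w j"
  then show "e v = e w"
    using arith_rel_cong[OF assms[OF order_refl arith_fun_const[of _ "e v"]], of v w] by simp
next
  fix i assume "d \<le> i"
  then show "arith_rel (Suc i) (\<lambda>v. v i = e v)"
    using assms[of "Suc i" "\<lambda>v. v i"] arith_fun_var[of i "Suc i"] by simp
qed

text \<open>The graph of \<open>f\<close> is only needed for bare variables. The arguments sit above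
  the result variable \<open>i\<close>, so they can be substituted from the top down, each by an
  expression of lower level.\<close>

lemma arith_fun_binary_aux:
  assumes "\<And>i. arith_rel (Suc (Suc (Suc i))) (\<lambda>v. v i = f (v (Suc i)) (v (Suc (Suc i))))"
    and e: "arith_fun d e" "arith_fun d e'"
  shows "arith_fun d (\<lambda>v. f (e v) (e' v))"
  unfolding arith_fun_def
proof (intro conjI allI impI)
  fix v w :: "nat \<Rightarrow> nat" assume "\<forall>j<d. v j = w j"
  then show "f (e v) (e' v) = f (e w) (e' w)" using e[THEN arith_fun_cong] by metis
next
  fix i assume i: "d \<le> i"
  have "arith_fun (Suc i) e" "arith_fun (Suc (Suc i)) e'"
    using e i by (auto intro: arith_fun_mono)
  from arith_rel_subst[OF arith_rel_subst[OF assms(1) this(2)] this(1)]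
  show "arith_rel (Suc i) (\<lambda>v. v i = f (e v) (e' v))"
    using i arith_fun_upd[OF e(2)] by simp
qed

lemma arith_fun_add: "arith_fun d e \<Longrightarrow> arith_fun d e' \<Longrightarrow> arith_fun d (\<lambda>v. e v + e' v)"
proof (erule (1) arith_fun_binary_aux[rotated])
  show "arith_rel (Suc (Suc (Suc i))) (\<lambda>v. v i = v (Suc i) + v (Suc (Suc i)))" for i
    by (rule arith_relI[OF inert_Equal[of "Var i" "Plus (Var (Suc i)) (Var (Suc (Suc i)))"]]) auto
qed

lemma arith_fun_mult: "arith_fun d e \<Longrightarrow> arith_fun d e' \<Longrightarrow> arith_fun d (\<lambda>v. e v * e' v)"
proof (erule (1) arith_fun_binary_aux[rotated])
  show "arith_rel (Suc (Suc (Suc i))) (\<lambda>v. v i = v (Suc i) * v (Suc (Suc i)))" for i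
    by (rule arith_relI[OF inert_Equal[of "Var i" "Times (Var (Suc i)) (Var (Suc (Suc i)))"]]) auto
qed


section \<open>Arithmetical functions\<close>

lemma arith_fun_Suc: "arith_fun d e \<Longrightarrow> arith_fun d (\<lambda>v. Suc (e v))"
  using arith_fun_add[OF _ arith_fun_const[of _ 1]] by simp

lemma arith_rel_le: "arith_fun d e \<Longrightarrow> arith_fun d e' \<Longrightarrow> arith_rel d (\<lambda>v. e v \<le> e' v)"
  unfolding le_iff_add
  by (rule arith_rel_ex) (intro arith_rel_eq arith_fun_add; blast intro: arith_fun_mono)

lemma arith_rel_less: "arith_fun d e \<Longrightarrow> arith_fun d e' \<Longrightarrow> arith_rel d (\<lambda>v. e v < e' v)"
  unfolding less_eq_Suc_le by (intro arith_rel_le arith_fun_Suc)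

lemma arith_rel_dvd: "arith_fun d e \<Longrightarrow> arith_fun d e' \<Longrightarrow> arith_rel d (\<lambda>v. e v dvd e' v)"
  unfolding dvd_def
  by (rule arith_rel_ex) (intro arith_rel_eq arith_fun_mult; blast intro: arith_fun_mono)

lemma arith_rel_all_less:
  assumes "arith_fun d b"
    and "\<And>d' e. d \<le> d' \<Longrightarrow> arith_fun d' e \<Longrightarrow> arith_rel d' (\<lambda>v. Q v (e v))"
  shows "arith_rel d (\<lambda>v. \<forall>y<b v. Q v y)"
  by (intro arith_rel_all arith_rel_imp arith_rel_less assms arith_fun_mono[OF assms(1)])

lemma arith_rel_ex_less:
  assumes "arith_fun d b"
    and "\<And>d' e. d \<le> d' \<Longrightarrow> arith_fun d' e \<Longrightarrow> arith_rel d' (\<lambda>v. Q v (e v))"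
  shows "arith_rel d (\<lambda>v. \<exists>y<b v. Q v y)"
  by (intro arith_rel_ex arith_rel_conj arith_rel_less assms arith_fun_mono[OF assms(1)])

lemma arith_fun_if:
  assumes "arith_rel d P" "arith_fun d e" "arith_fun d e'"
  shows "arith_fun d (\<lambda>v. if P v then e v else e' v)"
proof (rule arith_funI)
  fix d' x assume d: "d \<le> d'" and x: "arith_fun d' x"
  have *: "x v = (if P v then e v else e' v) \<longleftrightarrow> (P v \<and> x v = e v) \<or> (\<not> P v \<and> x v = e' v)" for v
    by simp
  show "arith_rel d' (\<lambda>v. x v = (if P v then e v else e' v))"
    unfolding *
    by (intro arith_rel_disj arith_rel_conj arith_rel_not arith_rel_eq x d
        arith_rel_mono[OF assms(1)] arith_fun_mono[OF assms(2)] arith_fun_mono[OF assms(3)])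
qed

lemma arith_fun_diff:
  assumes "arith_fun d e" "arith_fun d e'"
  shows "arith_fun d (\<lambda>v. e v - e' v)"
proof (rule arith_funI)
  fix d' x assume d: "d \<le> d'" and x: "arith_fun d' x"
  have *: "x v = e v - e' v \<longleftrightarrow> e v = e' v + x v \<or> (e v < e' v \<and> x v = 0)" for v
    by auto
  show "arith_rel d' (\<lambda>v. x v = e v - e' v)"
    unfolding *
    by (intro arith_rel_disj arith_rel_conj arith_rel_eq arith_rel_less arith_fun_add arith_fun_const
        x d arith_fun_mono[OF assms(1)] arith_fun_mono[OF assms(2)])
qed

lemma arith_fun_div:
  assumes "arith_fun d e" "arith_fun d e'"
  shows "arith_fun d (\<lambda>v. e v div e' v)"
proof (rule arith_funI)
  fix d' x assume d: "d \<le> d'" and x: "arith_fun d' x"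
  \<comment> \<open>The first disjunct accounts for the convention \<open>a div 0 = 0\<close>; for
    \<open>b = 0\<close> the second one is unsatisfiable.\<close>
  have *: "m = a div b \<longleftrightarrow> (b = 0 \<and> m = 0) \<or> (m * b \<le> a \<and> a < Suc m * b)" for m a b :: nat
    by (cases "b = 0") (auto simp: div_nat_eqI less_eq_div_iff_mult_less_eq dividend_less_times_div
       mult.commute intro: div_nat_eqI[symmetric])
  show "arith_rel d' (\<lambda>v. x v = e v div e' v)"
    unfolding *
    by (intro arith_rel_disj arith_rel_conj arith_rel_eq arith_rel_less arith_rel_le arith_fun_mult
        arith_fun_Suc arith_fun_const x d arith_fun_mono[OF assms(1)] arith_fun_mono[OF assms(2)])
qed

lemma arith_fun_mod: "arith_fun d e \<Longrightarrow> arith_fun d e' \<Longrightarrow> arith_fun d (\<lambda>v. e v mod e' v)"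
  unfolding minus_mult_div_eq_mod[symmetric]
  by (intro arith_fun_diff arith_fun_mult arith_fun_div)

lemma arith_fun_prod_encode:
  "arith_fun d e \<Longrightarrow> arith_fun d e' \<Longrightarrow> arith_fun d (\<lambda>v. prod_encode (e v, e' v))"
  unfolding prod_encode_def triangle_def case_prod_conv
  by (intro arith_fun_add arith_fun_div arith_fun_mult arith_fun_Suc arith_fun_const)

definition pfst :: "nat \<Rightarrow> nat" where "pfst n = fst (prod_decode n)"
definition psnd :: "nat \<Rightarrow> nat" where "psnd n = snd (prod_decode n)"

lemma pfst_encode [simp]: "pfst (prod_encode (a, b)) = a"
  and psnd_encode [simp]: "psnd (prod_encode (a, b)) = b"
  by (simp_all add: pfst_def psnd_def)

lemma prod_encode_pfst_psnd [simp]: "prod_encode (pfst n, psnd n) = n"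
  by (simp add: pfst_def psnd_def)

lemma arith_fun_pfst:
  assumes "arith_fun d e" shows "arith_fun d (\<lambda>v. pfst (e v))"
proof (rule arith_funI)
  fix d' x assume d: "d \<le> d'" and x: "arith_fun d' x"
  have *: "m = pfst n \<longleftrightarrow> (\<exists>b. prod_encode (m, b) = n)" for m n
    using prod_encode_pfst_psnd pfst_encode by metis
  show "arith_rel d' (\<lambda>v. x v = pfst (e v))"
    unfolding *
    by (rule arith_rel_ex, intro arith_rel_eq arith_fun_prod_encode)
      (blast intro: arith_fun_mono order_trans assms x d)+
qed

lemma arith_fun_psnd:
  assumes "arith_fun d e" shows "arith_fun d (\<lambda>v. psnd (e v))"
proof (rule arith_funI)
  fix d' x assume d: "d \<le> d'" and x: "arith_fun d' x"
  have *: "m = psnd n \<longleftrightarrow> (\<exists>a. prod_encode (a, m) = n)" for m n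
    using prod_encode_pfst_psnd psnd_encode by metis
  show "arith_rel d' (\<lambda>v. x v = psnd (e v))"
    unfolding *
    by (rule arith_rel_ex, intro arith_rel_eq arith_fun_prod_encode)
      (blast intro: arith_fun_mono order_trans assms x d)+
qed

text \<open>
  Goedel's trick, for sets instead of sequences: a finite set is coded by the divisors of a product
  of pairwise coprime moduli.
\<close>

definition in_code :: "nat \<Rightarrow> nat \<Rightarrow> bool" where
  "in_code c t \<longleftrightarrow> t < pfst c \<and> Suc (Suc t * pfst (psnd c)) dvd psnd (psnd c)"

text \<open>A common divisor of two moduli with indices \<open>s < t < N\<close> divides
  \<open>(t - s) * fact N\<close> and is coprime to \<open>fact N\<close>. Hence it divides
  \<open>t - s\<close>, which itself divides \<open>fact N\<close>, so it is a unit. A modulus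
  therefore divides the product only if it is one of the factors.\<close>

lemma in_code_exists:
  assumes "finite H"
  shows "\<exists>c. \<forall>t. in_code c t \<longleftrightarrow> t \<in> H"
proof -
  obtain N where N: "\<And>t. t \<in> H \<Longrightarrow> t < N"
    using assms finite_nat_set_iff_bounded by auto
  define m where "m t = Suc (Suc t * fact N)" for t
  have cop: "coprime (m s) (m t)" if "s < t" "t < N" for s t
  proof (rule coprimeI)
    fix c assume c: "c dvd m s" "c dvd m t"
    have cf: "coprime c (fact N)"
    proof (rule coprime_divisors[OF c(1) dvd_refl])
      show "coprime (m s) (fact N)"
      proof (rule coprimeI)
        fix b assume "b dvd m s" "b dvd fact N"
        then have "b dvd m s - Suc s * fact N" by (intro dvd_diff_nat) (auto intro: dvd_mult)
        then show "is_unit b" by (simp add: m_def)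
      qed
    qed
    have "c dvd m t - m s" using c by (rule dvd_diff_nat[rotated])
    also have "m t - m s = (t - s) * fact N"
      using that by (simp add: m_def algebra_simps diff_mult_distrib)
    finally have "c dvd t - s" using cf by (simp add: coprime_dvd_mult_left_iff)
    then have "c dvd fact N"
      using that by (intro dvd_trans[OF _ dvd_fact]) auto
    then show "is_unit c" using cf by (meson coprime_common_divisor dvd_refl)
  qed
  let ?c = "prod_encode (N, prod_encode (fact N, \<Prod>s\<in>H. m s))"
  have "in_code ?c t \<longleftrightarrow> t \<in> H" for t
  proof
    assume "t \<in> H"
    then show "in_code ?c t"
      using N assms dvd_prodI[of H t m] unfolding in_code_def m_def by simp
  next
    assume *: "in_code ?c t"
    show "t \<in> H"
    proof (rule ccontr)
      assume "t \<notin> H"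
      have "coprime (m t) (m s)" if "s \<in> H" for s
      proof (cases "s < t")
        case True
        \<comment> \<open>Here the bound stored in the code is used: coprimality of the moduli is
          known only for indices below \<open>N\<close>.\<close>
        moreover have "t < N" using * by (simp add: in_code_def)
        ultimately show ?thesis using cop[of s t] by (simp add: coprime_commute)
      next
        case False
        with that \<open>t \<notin> H\<close> have "t < s" by (cases s t rule: linorder_cases) auto
        then show ?thesis using cop N[OF that] by blast
      qed
      then have "coprime (m t) (\<Prod>s\<in>H. m s)" by (intro prod_coprime_right)
      moreover have "m t dvd (\<Prod>s\<in>H. m s)" using * by (simp add: in_code_def m_def)
      ultimately have "is_unit (m t)" by (rule coprime_common_divisor[OF _ dvd_refl])
      then show False by (simp add: m_def)
    qed
  qed
  then show ?thesis by blast
qed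

lemma arith_rel_in_code:
  "arith_fun d e \<Longrightarrow> arith_fun d e' \<Longrightarrow> arith_rel d (\<lambda>v. in_code (e v) (e' v))"
  unfolding in_code_def
  by (intro arith_rel_conj arith_rel_less arith_rel_dvd arith_fun_Suc arith_fun_mult
      arith_fun_pfst arith_fun_psnd)

text \<open>The coded set contains the pairs of \<open>k\<close> and the \<open>k\<close>-th iterate.\<close>

lemma funpow_eq_iff_in_code:
  "y = (f ^^ n) a \<longleftrightarrow>
    (\<exists>c. in_code c (prod_encode (n, y)) \<and>
      (\<forall>t. in_code c t \<longrightarrow> (pfst t = 0 \<and> psnd t = a) \<or>
        (\<exists>s. in_code c s \<and> pfst t = Suc (pfst s) \<and> psnd t = f (psnd s))))"
  (is "_ \<longleftrightarrow> (\<exists>c. ?C c)")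
proof
  assume y: "y = (f ^^ n) a"
  define h where "h k = prod_encode (k, (f ^^ k) a)" for k
  obtain c where c: "\<And>t. in_code c t \<longleftrightarrow> t \<in> h ` {..n}"
    using in_code_exists[of "h ` {..n}"] by blast
  have h: "(pfst (h k) = 0 \<and> psnd (h k) = a) \<or>
      (\<exists>s. in_code c s \<and> pfst (h k) = Suc (pfst s) \<and> psnd (h k) = f (psnd s))" if "k \<le> n" for k
  proof (cases k)
    case (Suc j)
    then show ?thesis
      using that by (intro disjI2 exI[of _ "h j"]) (auto simp: c h_def)
  qed (simp add: h_def)
  show "\<exists>c. ?C c"
  proof (intro exI[of _ c] conjI allI impI)
    show "in_code c (prod_encode (n, y))"
      using y by (auto simp: c h_def)
    fix t assume "in_code c t"
    then obtain k where "k \<le> n" "t = h k" by (auto simp: c)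
    then show "(pfst t = 0 \<and> psnd t = a) \<or>
        (\<exists>s. in_code c s \<and> pfst t = Suc (pfst s) \<and> psnd t = f (psnd s))"
      using h by simp
  qed
next
  assume "\<exists>c. ?C c"
  then obtain c where "?C c" ..
  then have n: "in_code c (prod_encode (n, y))"
    and c: "in_code c t \<Longrightarrow> (pfst t = 0 \<and> psnd t = a) \<or>
        (\<exists>s. in_code c s \<and> pfst t = Suc (pfst s) \<and> psnd t = f (psnd s))" for t
    by simp_all
  \<comment> \<open>Every coded pair descends to a predecessor in the code until its first component
    is 0, which forces it onto the orbit of \<open>a\<close>. The code may contain pairs other than
    the intended ones.\<close>
  have "psnd t = (f ^^ pfst t) a" if "in_code c t" for t
    using that
  proof (induction "pfst t" arbitrary: t)
    case 0
    then show ?case using c[OF \<open>in_code c t\<close>] by auto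
  next
    case (Suc k)
    then obtain s where "in_code c s" "pfst t = Suc (pfst s)" "psnd t = f (psnd s)"
      using c[OF \<open>in_code c t\<close>] by auto
    then show ?case using Suc.hyps by simp
  qed
  from this[OF n] show "y = (f ^^ n) a" by simp
qed

section \<open>Iteration, recursion and counting\<close>

lemma arith_fun_funpow:
  assumes F: "\<And>d' e. d \<le> d' \<Longrightarrow> arith_fun d' e \<Longrightarrow> arith_fun d' (\<lambda>v. F v (e v))"
    and n: "arith_fun d n" and a: "arith_fun d a"
  shows "arith_fun d (\<lambda>v. (F v ^^ n v) (a v))"
proof (rule arith_funI)
  fix d' y assume d: "d \<le> d'" and y: "arith_fun d' y"
  have step: "arith_rel d'' (\<lambda>v. in_code (c v) (t v) \<longrightarrow> (pfst (t v) = 0 \<and> psnd (t v) = a v) \<or>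
      (\<exists>s. in_code (c v) s \<and> pfst (t v) = Suc (pfst s) \<and> psnd (t v) = F v (psnd s)))"
    if "d \<le> d''" "arith_fun d'' c" "arith_fun d'' t" for d'' c t
  proof -
    have "arith_rel d3 (\<lambda>v. in_code (c v) (s v) \<and> pfst (t v) = Suc (pfst (s v)) \<and>
        psnd (t v) = F v (psnd (s v)))"
      if "d'' \<le> d3" "arith_fun d3 s" for d3 s
      using that \<open>d \<le> d''\<close> \<open>arith_fun d'' c\<close>[THEN arith_fun_mono] \<open>arith_fun d'' t\<close>[THEN arith_fun_mono]
      by (intro arith_rel_conj arith_rel_in_code arith_rel_eq arith_fun_pfst arith_fun_psnd
          arith_fun_Suc F) auto
    then have "arith_rel d'' (\<lambda>v. \<exists>s. in_code (c v) s \<and> pfst (t v) = Suc (pfst s) \<and>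
        psnd (t v) = F v (psnd s))"
      by (rule arith_rel_ex)
    then show ?thesis
      using that a[THEN arith_fun_mono]
      by (intro arith_rel_imp arith_rel_in_code arith_rel_disj arith_rel_conj arith_rel_eq
          arith_fun_pfst arith_fun_psnd arith_fun_const) auto
  qed
  have "arith_rel d'' (\<lambda>v. in_code (c v) (prod_encode (n v, y v)) \<and>
      (\<forall>t. in_code (c v) t \<longrightarrow> (pfst t = 0 \<and> psnd t = a v) \<or>
        (\<exists>s. in_code (c v) s \<and> pfst t = Suc (pfst s) \<and> psnd t = F v (psnd s))))"
    if "d' \<le> d''" "arith_fun d'' c" for d'' c
    using d that n[THEN arith_fun_mono] y[THEN arith_fun_mono] that(2)[THEN arith_fun_mono]
    by (intro arith_rel_conj arith_rel_in_code arith_fun_prod_encode arith_rel_all step) auto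
  then show "arith_rel d' (\<lambda>v. y v = (F v ^^ n v) (a v))"
    unfolding funpow_eq_iff_in_code by (rule arith_rel_ex)
qed

text \<open>The iterated map carries the counter along with the value, so primitive recursion
  reduces to iteration.\<close>

lemma rec_nat_conv_funpow:
  "rec_nat a f n = psnd (((\<lambda>c. prod_encode (Suc (pfst c), f (pfst c) (psnd c))) ^^ n) (prod_encode (0, a)))"
proof -
  have "((\<lambda>c. prod_encode (Suc (pfst c), f (pfst c) (psnd c))) ^^ n) (prod_encode (0, a))
    = prod_encode (n, rec_nat a f n)"
    by (induction n) auto
  then show ?thesis by simp
qed

lemma arith_fun_rec_nat:
  assumes f: "\<And>d' e e'. d \<le> d' \<Longrightarrow> arith_fun d' e \<Longrightarrow> arith_fun d' e' \<Longrightarrow> arith_fun d' (\<lambda>v. f v (e v) (e' v))"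
    and "arith_fun d n" "arith_fun d a"
  shows "arith_fun d (\<lambda>v. rec_nat (a v) (f v) (n v))"
  unfolding rec_nat_conv_funpow
  by (intro arith_fun_psnd arith_fun_funpow arith_fun_prod_encode arith_fun_Suc arith_fun_pfst f
      arith_fun_const assms(2,3))

lemma arith_fun_power:
  assumes "arith_fun d e" "arith_fun d e'"
  shows "arith_fun d (\<lambda>v. e v ^ e' v)"
proof -
  have *: "a ^ n = ((\<lambda>y. a * y) ^^ n) 1" for a n :: nat
    by (induction n) auto
  show ?thesis
    unfolding *
    by (intro arith_fun_funpow arith_fun_mult arith_fun_const assms arith_fun_mono[OF assms(1)])
qed

lemma card_less_conv_rec_nat:
  "card {x. x < n \<and> Q x} = rec_nat 0 (\<lambda>x c. if Q x then Suc c else c) n"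
proof (induction n)
  case (Suc n)
  have "{x. x < Suc n \<and> Q x} = (if Q n then insert n {x. x < n \<and> Q x} else {x. x < n \<and> Q x})"
    by (auto simp: less_Suc_eq)
  then show ?case using Suc by simp
qed simp

lemma arith_fun_card_less:
  assumes "\<And>d' e. d \<le> d' \<Longrightarrow> arith_fun d' e \<Longrightarrow> arith_rel d' (\<lambda>v. Q v (e v))"
    and "arith_fun d n"
  shows "arith_fun d (\<lambda>v. card {x. x < n v \<and> Q v x})"
  unfolding card_less_conv_rec_nat
  by (intro arith_fun_rec_nat arith_fun_if arith_fun_Suc arith_fun_const assms)


section \<open>Arithmetisation of oracle programs\<close>

text \<open>Halting configurations become fixed points, so a run is an iterate of a total function,
  as \<open>arith_fun_funpow\<close> requires.\<close>

definition total_step :: "program \<Rightarrow> bit_sequence \<Rightarrow> config \<Rightarrow> config" where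
  "total_step P u c = (case step P u c of None \<Rightarrow> c | Some d \<Rightarrow> d)"

definition run :: "nat \<Rightarrow> bit_sequence \<Rightarrow> nat \<Rightarrow> nat \<Rightarrow> config" where
  "run p u n t = (total_step (program_of p) u ^^ t) (initial_config n)"

definition halts_at :: "nat \<Rightarrow> bit_sequence \<Rightarrow> nat \<Rightarrow> nat \<Rightarrow> bool" where
  "halts_at p u n t \<longleftrightarrow> step (program_of p) u (run p u n t) = None"

lemma run_Suc: "run p u n (Suc t) = total_step (program_of p) u (run p u n t)"
  by (simp add: run_def)

lemma computes_iff_run: "computes p u n m \<longleftrightarrow> (\<exists>t. halts_at p u n t \<and> output_of (run p u n t) = m)"
proof
  let ?R = "\<lambda>c d. step (program_of p) u c = Some d"
  assume "computes p u n m"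
  then obtain c k where c: "(?R ^^ k) (initial_config n) c" "step (program_of p) u c = None"
      "output_of c = m"
    unfolding computes_def rtranclp_power by auto
  have "run p u n k = c" if "(?R ^^ k) (initial_config n) c" for k c
    using that
  proof (induction k arbitrary: c)
    case 0
    then show ?case by (simp add: run_def)
  next
    case (Suc k)
    then obtain b where "(?R ^^ k) (initial_config n) b" "?R b c" by auto
    with Suc.IH[of b] show ?case by (simp add: run_Suc total_step_def)
  qed
  from this[OF c(1)] c(2,3) show "\<exists>t. halts_at p u n t \<and> output_of (run p u n t) = m"
    by (auto simp: halts_at_def)
next
  let ?R = "\<lambda>c d. step (program_of p) u c = Some d"
  assume "\<exists>t. halts_at p u n t \<and> output_of (run p u n t) = m"
  then obtain t where t: "halts_at p u n t" "output_of (run p u n t) = m" by blast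
  have "?R\<^sup>*\<^sup>* (initial_config n) (run p u n t)" for t
  proof (induction t)
    case 0
    show ?case by (simp add: run_def)
  next
    case (Suc t)
    show ?case
    proof (cases "step (program_of p) u (run p u n t)")
      case None
      then show ?thesis using Suc by (simp add: run_Suc total_step_def)
    next
      case (Some d)
      then have "run p u n (Suc t) = d" by (simp add: run_Suc total_step_def)
      with Some have "?R (run p u n t) (run p u n (Suc t))" by simp
      with Suc show ?thesis by (rule rtranclp.rtrancl_into_rtrancl)
    qed
  qed
  with t show "computes p u n m"
    unfolding computes_def halts_at_def by (intro exI[of _ "run p u n t"] conjI)
qed

text \<open>The cell nearest to the head is the lowest binary digit: the scanned symbol is a parity,
  and a head move halves one half-tape and doubles the other. Blanks at the far end do not change
  the code.\<close>

primrec tape_code :: "bool list \<Rightarrow> nat" where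
  "tape_code [] = 0"
| "tape_code (b # bs) = of_bool b + 2 * tape_code bs"

lemma tape_code_tl: "tape_code (tl bs) = tape_code bs div 2"
  by (cases bs) auto

lemma scanned_eq_odd_tape_code: "scanned bs \<longleftrightarrow> odd (tape_code bs)"
  by (cases bs) auto

lemma set_decode_double_plus: "set_decode (of_bool b + 2 * n) = (if b then {0} else {}) \<union> Suc ` set_decode n"
proof (rule set_eqI)
  fix i show "i \<in> set_decode (of_bool b + 2 * n) \<longleftrightarrow> i \<in> (if b then {0} else {}) \<union> Suc ` set_decode n"
    by (cases i) auto
qed

lemma count_list_conv_card: "count_list bs True = card (set_decode (tape_code bs))"
proof (induction bs)
  case (Cons b bs)
  have "card (Suc ` set_decode (tape_code bs)) = card (set_decode (tape_code bs))"
    by (intro card_image) simp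
  moreover have "card (insert 0 (Suc ` set_decode (tape_code bs))) = Suc (card (Suc ` set_decode (tape_code bs)))"
    by (intro card_insert_disjoint) auto
  ultimately show ?case
    using Cons by (cases b) (simp_all add: set_decode_double_plus[of True, simplified] set_decode_double_plus[of False, simplified])
qed simp

lemma tape_code_replicate: "tape_code (replicate n True) = 2 ^ n - 1"
proof -
  have "Suc (tape_code (replicate n True)) = 2 ^ n"
    by (induction n) auto
  then show ?thesis by simp
qed

section \<open>Simulation of the machine on codes\<close>

fun config_code :: "config \<Rightarrow> nat" where
  "config_code (q, i, l, r) = prod_encode (q, prod_encode (i, prod_encode (tape_code l, tape_code r)))"

text \<open>A nonempty list is encoded as the successor of a pair of head and tail, whence the
  subtraction of 1.\<close>

definition head_code :: "nat \<Rightarrow> nat" where "head_code x = pfst (x - 1)"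
definition tail_code :: "nat \<Rightarrow> nat" where "tail_code x = psnd (x - 1)"

lemma list_decode_conv: "list_decode x = (if x = 0 then [] else head_code x # list_decode (tail_code x))"
  by (cases x) (simp_all add: head_code_def tail_code_def pfst_def psnd_def split: prod.split)

lemma tail_code_less: "x \<noteq> 0 \<Longrightarrow> tail_code x < x"
  using le_prod_encode_2[of "psnd (x - 1)" "pfst (x - 1)"] by (simp add: tail_code_def)

text \<open>The two lowest binary digits of \<open>n mod 72\<close> are the oracle bit and the
  scanned symbol of the key, so \<open>s\<close> packs both as a remainder modulo 4.\<close>

definition matches :: "nat \<Rightarrow> nat \<Rightarrow> nat \<Rightarrow> bool" where
  "matches q s n \<longleftrightarrow> pfst (n div 72) = q \<and> n mod 72 mod 4 = s"

lemma matches_iff: "matches q (of_bool a + 2 * of_bool b) n \<longleftrightarrow> fst (entry_of_nat n) = (q, a, b)"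
proof -
  have "k mod 4 = of_bool a + 2 * of_bool b \<longleftrightarrow> (odd k \<longleftrightarrow> a) \<and> (odd (k div 2) \<longleftrightarrow> b)" for k :: nat
    by (cases a; cases b; simp; presburger)
  moreover have "fst (entry_of_nat n) = (pfst (n div 72), odd (n mod 72), odd (n mod 72 div 2))"
    unfolding entry_of_nat_def Let_def pfst_def by (simp only: split_beta fst_conv)
  ultimately show ?thesis
    unfolding matches_def by (simp only: prod.inject)
qed

definition skip_entry :: "nat \<Rightarrow> nat \<Rightarrow> nat \<Rightarrow> nat" where
  "skip_entry q s x = (if x = 0 \<or> matches q s (head_code x) then x else tail_code x)"

text \<open>Both 0 and a list starting with a matching entry are fixed points of
  \<open>skip_entry\<close>, and otherwise the code strictly decreases. So \<open>p\<close>
  iterations reach the first matching entry, or 0 if there is none.\<close>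

definition lookup_code :: "nat \<Rightarrow> nat \<Rightarrow> nat \<Rightarrow> nat" where
  "lookup_code q s p = (skip_entry q s ^^ p) p"

lemma map_of_skip_entry:
  "x \<le> N \<Longrightarrow> map_of (map entry_of_nat (list_decode x)) (q, a, b) =
    (let y = (skip_entry q (of_bool a + 2 * of_bool b) ^^ N) x
     in if y = 0 then None else Some (snd (entry_of_nat (head_code y))))"
proof (induction N arbitrary: x)
  case 0
  then show ?case by simp
next
  case (Suc N)
  let ?skip = "skip_entry q (of_bool a + 2 * of_bool b)"
  have fixpoint: "(?skip ^^ M) x = x" if "?skip x = x" for M x
    using that by (induction M) auto
  consider "x = 0" | "x \<noteq> 0" "fst (entry_of_nat (head_code x)) = (q, a, b)"
    | "x \<noteq> 0" "fst (entry_of_nat (head_code x)) \<noteq> (q, a, b)" by blast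
  then show ?case
  proof cases
    case 1
    then have "?skip x = x" by (simp add: skip_entry_def)
    from fixpoint[OF this, of "Suc N"] 1 show ?thesis by (simp add: Let_def del: funpow.simps)
  next
    case 2
    then have "?skip x = x" by (simp add: skip_entry_def matches_iff)
    from fixpoint[OF this, of "Suc N"] 2 show ?thesis
      by (cases "entry_of_nat (head_code x)") (simp add: list_decode_conv[of x] Let_def del: funpow.simps)
  next
    case 3
    then have "?skip x = tail_code x" by (simp add: skip_entry_def matches_iff)
    then have "(?skip ^^ Suc N) x = (?skip ^^ N) (tail_code x)" by (simp add: funpow_swap1)
    moreover have "tail_code x \<le> N" using tail_code_less[OF 3(1)] Suc.prems by simp
    note Suc.IH[OF this]
    ultimately show ?thesis
      using 3 by (cases "entry_of_nat (head_code x)") (simp add: list_decode_conv[of x] Let_def del: funpow.simps)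
  qed
qed

lemma map_of_program_of:
  "map_of (program_of p) (q, a, b) =
    (let y = lookup_code q (of_bool a + 2 * of_bool b) p
     in if y = 0 then None else Some (snd (entry_of_nat (head_code y))))"
  unfolding program_of_def lookup_code_def by (rule map_of_skip_entry) simp

text \<open>A number is read as its binary digits followed by zeros. The numbers below
  \<open>2 ^ k\<close> then represent each oracle prefix of length \<open>k\<close> exactly
  once.\<close>

definition oracle_of :: "nat \<Rightarrow> bit_sequence" where
  "oracle_of x i \<longleftrightarrow> i \<in> set_decode x"

definition state_of :: "nat \<Rightarrow> nat" where "state_of c = pfst c"
definition position_of :: "nat \<Rightarrow> nat" where "position_of c = pfst (psnd c)"
definition left_of :: "nat \<Rightarrow> nat" where "left_of c = pfst (psnd (psnd c))"
definition right_of :: "nat \<Rightarrow> nat" where "right_of c = psnd (psnd (psnd c))"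

text \<open>\<open>x div 2 ^ position_of c mod 2\<close> is the oracle bit under the head. The
  result is a list code whose head is the applicable entry; 0 means that the machine has
  halted.\<close>

definition entry_index :: "nat \<Rightarrow> nat \<Rightarrow> nat \<Rightarrow> nat" where
  "entry_index p x c =
    lookup_code (state_of c) (x div 2 ^ position_of c mod 2 + 2 * (right_of c mod 2)) p"

definition written_code :: "nat \<Rightarrow> nat \<Rightarrow> nat" where
  "written_code k r = k div 4 mod 2 + 2 * (r div 2)"

definition moved_left_code :: "nat \<Rightarrow> nat \<Rightarrow> nat \<Rightarrow> nat" where
  "moved_left_code w l r = (if w = 0 then l div 2 else if w = 1 then l else r mod 2 + 2 * l)"

definition moved_right_code :: "nat \<Rightarrow> nat \<Rightarrow> nat \<Rightarrow> nat" where
  "moved_right_code w l r = (if w = 0 then l mod 2 + 2 * r else if w = 1 then r else r div 2)"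

definition moved_position :: "nat \<Rightarrow> nat \<Rightarrow> nat" where
  "moved_position w i = (if w = 0 then i - 1 else if w = 1 then i else i + 1)"

text \<open>The divisors 72, 24 and 8, and the 4 in \<open>written_code\<close>, extract the fields
  in the way \<open>entry_of_nat\<close> packs them.\<close>

definition apply_entry_code :: "nat \<Rightarrow> nat \<Rightarrow> nat" where
  "apply_entry_code n c =
    prod_encode (psnd (n div 72),
      prod_encode (moved_position (n mod 72 div 24) (position_of c),
        prod_encode
          (moved_left_code (n mod 72 div 8 mod 3) (left_of c) (written_code (n mod 72) (right_of c)),
           moved_right_code (n mod 72 div 8 mod 3) (left_of c) (written_code (n mod 72) (right_of c)))))"

definition step_code :: "nat \<Rightarrow> nat \<Rightarrow> nat \<Rightarrow> nat" where
  "step_code p x c =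
    (if entry_index p x c = 0 then c else apply_entry_code (head_code (entry_index p x c)) c)"

lemma config_code_proj [simp]:
  "state_of (config_code (q, i, l, r)) = q" "position_of (config_code (q, i, l, r)) = i"
  "left_of (config_code (q, i, l, r)) = tape_code l" "right_of (config_code (q, i, l, r)) = tape_code r"
  by (simp_all add: state_of_def position_of_def left_of_def right_of_def)

lemma of_bool_odd: "of_bool (odd n) = (n mod 2 :: nat)"
  by (simp add: mod2_eq_if)

lemma map_of_entry_index:
  "map_of (program_of p) (q, oracle_of x i, scanned r) =
    (let y = entry_index p x (config_code (q, i, l, r))
     in if y = 0 then None else Some (snd (entry_of_nat (head_code y))))"
  unfolding map_of_program_of entry_index_def config_code_proj
  by (simp only: oracle_of_def set_decode_def mem_Collect_eq scanned_eq_odd_tape_code of_bool_odd)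

lemma move_work_code:
  assumes "move_work (move_of_nat w) (l, r) = (l', r')"
  shows "tape_code l' = moved_left_code w (tape_code l) (tape_code r)"
    and "tape_code r' = moved_right_code w (tape_code l) (tape_code r)"
  using assms
  by (auto simp: moved_left_code_def moved_right_code_def tape_code_tl scanned_eq_odd_tape_code
      of_bool_odd split: if_splits)

lemma move_oracle_code: "move_oracle (move_of_nat w) i = moved_position w i"
  by (simp add: moved_position_def)

lemma config_code_total_step:
  "config_code (total_step (program_of p) (oracle_of x) c) = step_code p x (config_code c)"
proof -
  obtain q i l r where c: "c = (q, i, l, r)" by (metis prod_cases4)
  define y where "y = entry_index p x (config_code c)"
  define n where "n = head_code y"
  note lookup = map_of_entry_index[of p q x i r l, folded c, folded y_def, unfolded Let_def, folded n_def]
  show ?thesis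
  proof (cases "y = 0")
    case True
    then have "total_step (program_of p) (oracle_of x) c = c"
      using lookup by (simp add: total_step_def c)
    then show ?thesis
      using True unfolding step_code_def y_def[symmetric] by simp
  next
    case False
    define b where "b = odd (n mod 72 div 4)"
    obtain l' r' where lr: "move_work (move_of_nat (n mod 72 div 8 mod 3)) (l, b # tl r) = (l', r')"
      by fastforce
    have "snd (entry_of_nat n) = (psnd (n div 72), b, move_of_nat (n mod 72 div 8 mod 3), move_of_nat (n mod 72 div 24))"
      by (simp add: entry_of_nat_def Let_def psnd_def b_def split: prod.split)
    then have "total_step (program_of p) (oracle_of x) c =
        (psnd (n div 72), moved_position (n mod 72 div 24) i, l', r')"
      using lookup False lr by (simp add: total_step_def c move_oracle_code del: move_of_nat.simps)
    moreover have "tape_code (b # tl r) = written_code (n mod 72) (tape_code r)"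
      by (simp add: written_code_def tape_code_tl b_def of_bool_odd)
    ultimately show ?thesis
      using False move_work_code[OF lr]
      unfolding step_code_def y_def[symmetric] n_def[symmetric] apply_entry_code_def
      by (simp add: c del: config_code.simps(1)) simp
  qed
qed

lemma step_None_iff_entry_index:
  "step (program_of p) (oracle_of x) c = None \<longleftrightarrow> entry_index p x (config_code c) = 0"
proof -
  obtain q i l r where c: "c = (q, i, l, r)" by (metis prod_cases4)
  show ?thesis
    using map_of_entry_index[of p q x i r l] unfolding c
    by (simp add: Let_def del: config_code.simps split: prod.split)
qed

definition output_code :: "nat \<Rightarrow> nat" where
  "output_code c = card (set_decode (left_of c)) + card (set_decode (right_of c))"

text \<open>The start value codes the initial configuration: \<open>2 ^ Suc n - 1\<close> has
  \<open>n + 1\<close> binary digits, all of them one, for the marks of the input.\<close>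

definition run_code :: "nat \<Rightarrow> nat \<Rightarrow> nat \<Rightarrow> nat \<Rightarrow> nat" where
  "run_code p x n t =
    (step_code p x ^^ t) (prod_encode (0, prod_encode (0, prod_encode (0, 2 ^ Suc n - 1))))"

lemma run_code_eq: "run_code p x n t = config_code (run p (oracle_of x) n t)"
proof (induction t)
  case 0
  then show ?case
    by (simp add: run_code_def run_def initial_config_def tape_code_replicate del: power_Suc replicate_Suc)
next
  case (Suc t)
  then show ?case
    by (simp add: run_Suc config_code_total_step) (simp add: run_code_def)
qed

lemma halts_at_oracle_of: "halts_at p (oracle_of x) n t \<longleftrightarrow> entry_index p x (run_code p x n t) = 0"
  by (simp add: halts_at_def step_None_iff_entry_index run_code_eq)

lemma output_of_run_oracle_of: "output_of (run p (oracle_of x) n t) = output_code (run_code p x n t)"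
proof -
  obtain q i l r where c: "run p (oracle_of x) n t = (q, i, l, r)" by (metis prod_cases4)
  show ?thesis
    unfolding run_code_eq c output_code_def config_code_proj
    by (simp add: count_list_conv_card)
qed

text \<open>The output of \<open>p\<close> at \<open>n\<close> should realise an existential
  formula, and the witness is what this realiser outputs at 1. Both halting times lie below
  \<open>k\<close>, so only the first \<open>k\<close> oracle bits are consulted.\<close>

definition answers_within :: "nat \<Rightarrow> nat \<Rightarrow> nat \<Rightarrow> nat \<Rightarrow> bit_sequence \<Rightarrow> bool" where
  "answers_within k p n y u \<longleftrightarrow> (\<exists>s<k. halts_at p u n s \<and>
    (\<exists>t<k. halts_at (output_of (run p u n s)) u 1 t \<and>
      y \<le> output_of (run (output_of (run p u n s)) u 1 t)))"

text \<open>This is the relation \<open>P(n, y)\<close>. The inequality is a probability bound of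
  \<open>1 / 2 ^ n\<close> with denominators cleared, and quantifying over all \<open>k\<close>
  replaces the limit.\<close>

definition rarely_exceeded :: "nat \<Rightarrow> nat \<Rightarrow> bool" where
  "rarely_exceeded n y \<longleftrightarrow>
    (\<forall>p<Suc n. \<forall>k. card {x. x < 2 ^ k \<and> answers_within k p n y (oracle_of x)} * 2 ^ n \<le> 2 ^ k)"

section \<open>The simulation is arithmetical\<close>

lemma arith_fun_card_set_decode:
  assumes "arith_fun d e" shows "arith_fun d (\<lambda>v. card (set_decode (e v)))"
proof -
  \<comment> \<open>Since \<open>m < 2 ^ i\<close> for \<open>i \<ge> m\<close>, all digits of
    \<open>m\<close> have positions below \<open>m\<close>, and counting them becomes
    bounded.\<close>
  have *: "set_decode m = {i. i < m \<and> m div 2 ^ i mod 2 = 1}" for m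
  proof -
    have "i < m" if "m div 2 ^ i mod 2 = 1" for i
    proof (rule ccontr)
      assume "\<not> i < m"
      then have "m < 2 ^ i" using less_exp[of i] by linarith
      then show False using that by simp
    qed
    then show ?thesis by (auto simp: set_decode_def odd_iff_mod_2_eq_one)
  qed
  show ?thesis
    unfolding *
    by (intro arith_fun_card_less arith_rel_eq arith_fun_mod arith_fun_div arith_fun_power
        arith_fun_const assms) (auto intro: arith_fun_mono[OF assms])
qed

lemmas arith_fun_basic =
  arith_fun_const arith_fun_Suc arith_fun_add arith_fun_diff arith_fun_mult arith_fun_div arith_fun_mod
  arith_fun_power arith_fun_prod_encode arith_fun_pfst arith_fun_psnd arith_fun_if

lemma arith_fun_head_code: "arith_fun d e \<Longrightarrow> arith_fun d (\<lambda>v. head_code (e v))"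
  unfolding head_code_def by (intro arith_fun_basic)

lemma arith_fun_tail_code: "arith_fun d e \<Longrightarrow> arith_fun d (\<lambda>v. tail_code (e v))"
  unfolding tail_code_def by (intro arith_fun_basic)

lemma arith_fun_lookup_code:
  assumes "arith_fun d q" "arith_fun d s" "arith_fun d p"
  shows "arith_fun d (\<lambda>v. lookup_code (q v) (s v) (p v))"
  unfolding lookup_code_def
proof (intro arith_fun_funpow assms)
  fix d' e assume "d \<le> d'" "arith_fun d' e"
  then show "arith_fun d' (\<lambda>v. skip_entry (q v) (s v) (e v))"
    unfolding skip_entry_def matches_def
    by (intro arith_fun_basic arith_fun_head_code arith_fun_tail_code arith_rel_disj arith_rel_conj
        arith_rel_eq assms[THEN arith_fun_mono])
qed

lemma arith_fun_components:
  assumes "arith_fun d e"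
  shows "arith_fun d (\<lambda>v. state_of (e v))" "arith_fun d (\<lambda>v. position_of (e v))"
    "arith_fun d (\<lambda>v. left_of (e v))" "arith_fun d (\<lambda>v. right_of (e v))"
  unfolding state_of_def position_of_def left_of_def right_of_def
  by (intro arith_fun_basic assms)+

lemma arith_fun_entry_index:
  "arith_fun d p \<Longrightarrow> arith_fun d x \<Longrightarrow> arith_fun d c \<Longrightarrow>
    arith_fun d (\<lambda>v. entry_index (p v) (x v) (c v))"
  unfolding entry_index_def by (intro arith_fun_lookup_code arith_fun_basic arith_fun_components)

lemma arith_fun_apply_entry_code:
  assumes "arith_fun d n" "arith_fun d c" shows "arith_fun d (\<lambda>v. apply_entry_code (n v) (c v))"
  unfolding apply_entry_code_def moved_position_def moved_left_code_def moved_right_code_def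
    written_code_def
  by (intro arith_fun_basic arith_fun_components arith_rel_eq assms)

lemma arith_fun_step_code:
  "arith_fun d p \<Longrightarrow> arith_fun d x \<Longrightarrow> arith_fun d c \<Longrightarrow>
    arith_fun d (\<lambda>v. step_code (p v) (x v) (c v))"
  unfolding step_code_def
  by (intro arith_fun_if arith_rel_eq arith_fun_entry_index arith_fun_const arith_fun_apply_entry_code
      arith_fun_head_code)

lemma arith_fun_run_code:
  assumes "arith_fun d p" "arith_fun d x" "arith_fun d n" "arith_fun d t"
  shows "arith_fun d (\<lambda>v. run_code (p v) (x v) (n v) (t v))"
  unfolding run_code_def
  by (intro arith_fun_funpow arith_fun_step_code arith_fun_basic assms assms[THEN arith_fun_mono])

lemma arith_fun_output_code: "arith_fun d c \<Longrightarrow> arith_fun d (\<lambda>v. output_code (c v))"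
  unfolding output_code_def
  by (intro arith_fun_add arith_fun_card_set_decode arith_fun_components)

lemma arith_rel_answers_within:
  assumes "arith_fun d k" "arith_fun d p" "arith_fun d n" "arith_fun d y" "arith_fun d x"
  shows "arith_rel d (\<lambda>v. answers_within (k v) (p v) (n v) (y v) (oracle_of (x v)))"
proof -
  have inner: "arith_rel d' (\<lambda>v. \<exists>t<k v. entry_index (a v) (x v) (run_code (a v) (x v) 1 t) = 0 \<and>
      y v \<le> output_code (run_code (a v) (x v) 1 t))"
    if "d \<le> d'" "arith_fun d' a" for d' a
    using that
    by (intro arith_rel_ex_less arith_rel_conj arith_rel_eq arith_rel_le arith_fun_entry_index
        arith_fun_run_code arith_fun_output_code arith_fun_const assms[THEN arith_fun_mono]
        that(2)[THEN arith_fun_mono]) auto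
  show ?thesis
    unfolding answers_within_def halts_at_oracle_of output_of_run_oracle_of
    by (intro arith_rel_ex_less arith_rel_conj arith_rel_eq inner arith_fun_entry_index
        arith_fun_run_code arith_fun_output_code arith_fun_const assms assms[THEN arith_fun_mono])
qed

lemma arith_rel_rarely_exceeded: "arith_rel 2 (\<lambda>v. rarely_exceeded (v 0) (v 1))"
proof -
  have *: "arith_rel d (\<lambda>v. card {x. x < 2 ^ k v \<and> answers_within (k v) (p v) (n v) (y v) (oracle_of x)} * 2 ^ n v \<le> 2 ^ k v)"
    if "arith_fun d p" "arith_fun d n" "arith_fun d y" "arith_fun d k" for d p n y k
    by (intro arith_rel_le arith_fun_mult arith_fun_card_less arith_rel_answers_within arith_fun_power
        arith_fun_const that that[THEN arith_fun_mono])
  have "arith_rel d (\<lambda>v. \<forall>k. card {x. x < 2 ^ k \<and> answers_within k (p v) (v 0) (v 1) (oracle_of x)} * 2 ^ v 0 \<le> 2 ^ k)"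
    if "2 \<le> d" "arith_fun d p" for d p
    by (intro arith_rel_all * that(2)[THEN arith_fun_mono] arith_fun_var) (use that in auto)
  then show ?thesis
    unfolding rarely_exceeded_def
    by (intro arith_rel_all_less arith_fun_Suc arith_fun_var) auto
qed


section \<open>Probabilities of answers\<close>

interpretation coin: prob_space coin_measure
  by (rule prob_space_coin)

section \<open>Finitely determined events\<close>

lemma sets_coin_cylinder: "{u. \<forall>i<k. u i = w i} \<in> sets coin_measure"
proof -
  have "Measurable.pred coin_measure (\<lambda>u. u i = w i)" for i
    by (rule pred_coin_component)
  then have "Measurable.pred coin_measure (\<lambda>u. \<forall>i<k. u i = w i)"
    by measurable
  then show ?thesis by (simp add: pred_def)
qed

lemma prob_coin_cylinder: "coin.prob {u. \<forall>i<k. u i = w i} = 1 / 2 ^ k"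
proof -
  interpret product_prob_space "\<lambda>_. measure_pmf (bernoulli_pmf (1/2))" "UNIV :: nat set"
    by standard
  have half: "emeasure (measure_pmf (bernoulli_pmf (1/2))) {b} = ennreal (1/2)" for b
    by (cases b) (simp_all add: emeasure_pmf_single)
  have "emeasure coin_measure {u \<in> space coin_measure. \<forall>i\<in>{..<k}. u i \<in> {w i}} =
      (\<Prod>i<k. emeasure (measure_pmf (bernoulli_pmf (1/2))) {w i})"
    unfolding coin_measure_def by (rule emeasure_PiM_Collect) auto
  also have "\<dots> = ennreal ((1/2) ^ k)"
  proof -
    have "ennreal (1/2) ^ k = ennreal ((1/2) ^ k)" by (rule ennreal_power) simp
    then show ?thesis by (simp only: half prod_constant card_lessThan)
  qed
  finally have "emeasure coin_measure {u. \<forall>i<k. u i = w i} = ennreal ((1/2) ^ k)"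
    by (simp add: Ball_def)
  then show ?thesis by (simp add: measure_def power_one_over)
qed

lemma oracle_of_exists: "\<exists>x<2 ^ k. \<forall>i<k. oracle_of x i = u i"
proof (intro exI conjI)
  let ?x = "set_encode {i. i < k \<and> u i}"
  show "\<forall>i<k. oracle_of ?x i = u i"
    by (simp add: oracle_of_def)
  have "?x = (\<Sum>i | i < k \<and> u i. 2 ^ i)" by (simp add: set_encode_def)
  also have "\<dots> \<le> (\<Sum>i<k. 2 ^ i)" by (intro sum_mono2) auto
  also have "\<dots> < 2 ^ k"
    by (induction k) auto
  finally show "?x < 2 ^ k" .
qed

lemma oracle_of_unique:
  assumes "x < 2 ^ k" "y < 2 ^ k" "\<forall>i<k. oracle_of x i = oracle_of y i" shows "x = y"
proof -
  have "i \<notin> set_decode z" if "z < 2 ^ k" "k \<le> i" for z i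
  proof -
    have "z < 2 ^ i" using that power_increasing[of k i "2::nat"] by linarith
    then show ?thesis by (simp add: set_decode_def)
  qed
  then have "i \<in> set_decode x \<longleftrightarrow> i \<in> set_decode y" for i
    using assms by (cases "i < k") (auto simp: oracle_of_def)
  then have "set_decode x = set_decode y" by blast
  then show ?thesis by (metis set_decode_inverse)
qed

text \<open>The event is the disjoint union of the cylinders of the prefixes that satisfy it, each
  of probability \<open>1 / 2 ^ k\<close>.\<close>

lemma coin_finitely_determined:
  assumes "\<And>u u'. (\<forall>i<k. u i = u' i) \<Longrightarrow> Q u \<longleftrightarrow> Q u'"
  shows "{u. Q u} \<in> sets coin_measure"
    and "coin.prob {u. Q u} = card {x. x < 2 ^ k \<and> Q (oracle_of x)} / 2 ^ k"
proof -
  let ?X = "{x. x < 2 ^ k \<and> Q (oracle_of x)}"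
  define C where "C x = {u. \<forall>i<k. u i = oracle_of x i}" for x
  have union: "{u. Q u} = (\<Union>x\<in>?X. C x)"
  proof (intro set_eqI iffI)
    fix u assume u: "u \<in> {u. Q u}"
    obtain x where x: "x < 2 ^ k" "\<forall>i<k. oracle_of x i = u i"
      using oracle_of_exists by blast
    then have "Q (oracle_of x)" using u assms[of "oracle_of x" u] by simp
    then show "u \<in> (\<Union>x\<in>?X. C x)" using x by (auto simp: C_def)
  next
    fix u assume "u \<in> (\<Union>x\<in>?X. C x)"
    then obtain x where "Q (oracle_of x)" "\<forall>i<k. u i = oracle_of x i" by (auto simp: C_def)
    then show "u \<in> {u. Q u}" using assms[of u "oracle_of x"] by simp
  qed
  have sets: "C x \<in> sets coin_measure" for x
    unfolding C_def by (rule sets_coin_cylinder)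
  then show "{u. Q u} \<in> sets coin_measure"
    unfolding union by (intro sets.finite_UN) auto
  have "disjoint_family_on C ?X"
    unfolding disjoint_family_on_def
  proof (intro ballI impI)
    fix x y assume "x \<in> ?X" "y \<in> ?X" "x \<noteq> y"
    then show "C x \<inter> C y = {}"
      using oracle_of_unique[of x k y] by (auto simp: C_def)
  qed
  then have "coin.prob {u. Q u} = (\<Sum>x\<in>?X. coin.prob (C x))"
    unfolding union using sets by (intro coin.finite_measure_finite_Union) auto
  then show "coin.prob {u. Q u} = card ?X / 2 ^ k"
    by (simp add: C_def prob_coin_cylinder)
qed

section \<open>Finite use of the oracle\<close>

lemma move_oracle_le: "move_oracle m i \<le> Suc i"
  by (cases m) auto

lemma run_position: "fst (snd (run p u n t)) \<le> t"
proof (induction t)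
  case 0
  then show ?case by (simp add: run_def initial_config_def)
next
  case (Suc t)
  obtain q i l r where c: "run p u n t = (q, i, l, r)" by (metis prod_cases4)
  have "fst (snd (total_step P u (q, i, l, r))) \<le> Suc i" for P
    using move_oracle_le
    by (auto simp: total_step_def split: option.split prod.split)
  then show ?case using Suc c by (simp add: run_Suc) (meson Suc_le_mono le_trans)
qed

lemma step_cong: "u (fst (snd c)) = u' (fst (snd c)) \<Longrightarrow> step P u c = step P u' c"
  by (cases c) auto

lemma run_cong:
  assumes "\<forall>i<k. u i = u' i" "t \<le> k" shows "run p u n t = run p u' n t"
  using assms(2)
proof (induction t)
  case 0
  then show ?case by (simp add: run_def)
next
  case (Suc t)
  then have "fst (snd (run p u' n t)) < k" using run_position[of p u' n t] by simp
  then have "step (program_of p) u (run p u' n t) = step (program_of p) u' (run p u' n t)"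
    using assms(1) by (intro step_cong) blast
  then show ?case using Suc by (simp add: run_Suc total_step_def)
qed

text \<open>The bound is strict, unlike in \<open>run_cong\<close>: deciding whether the machine has
  halted at time \<open>t\<close> scans one more oracle bit, possibly at position
  \<open>t\<close>.\<close>

lemma halts_at_cong:
  assumes "\<forall>i<k. u i = u' i" "t < k" shows "halts_at p u n t \<longleftrightarrow> halts_at p u' n t"
proof -
  have "fst (snd (run p u' n t)) < k" using run_position[of p u' n t] assms(2) by simp
  then have "step (program_of p) u (run p u' n t) = step (program_of p) u' (run p u' n t)"
    using assms(1) by (intro step_cong) blast
  then show ?thesis
    using run_cong[OF assms(1), of t p n] assms(2) by (simp add: halts_at_def)
qed

lemma answers_within_cong:
  assumes "\<forall>i<k. u i = u' i" shows "answers_within k p n y u \<longleftrightarrow> answers_within k p n y u'"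
proof -
  have "run p u n t = run p u' n t" if "t < k" for p n t
    using run_cong[OF assms] that by simp
  then show ?thesis
    unfolding answers_within_def using halts_at_cong[OF assms] by (simp cong: conj_cong)
qed

lemma answers_within_mono: "answers_within k p n y u \<Longrightarrow> k \<le> k' \<Longrightarrow> answers_within k' p n y u"
  unfolding answers_within_def using less_le_trans[of _ k k'] by blast

lemma answers_within_antimono: "answers_within k p n y u \<Longrightarrow> y' \<le> y \<Longrightarrow> answers_within k p n y' u"
  unfolding answers_within_def using le_trans[of y' y] by blast

section \<open>Probabilities of large witnesses\<close>

definition answers :: "nat \<Rightarrow> nat \<Rightarrow> nat \<Rightarrow> bit_sequence \<Rightarrow> bool" where
  "answers p n y u \<longleftrightarrow> (\<exists>a m. computes p u n a \<and> computes a u 1 m \<and> y \<le> m)"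

lemma answers_iff: "answers p n y u \<longleftrightarrow> (\<exists>k. answers_within k p n y u)"
proof
  assume "answers p n y u"
  then obtain s t where "halts_at p u n s" "halts_at (output_of (run p u n s)) u 1 t"
      "y \<le> output_of (run (output_of (run p u n s)) u 1 t)"
    unfolding answers_def computes_iff_run by blast
  then have "answers_within (Suc (max s t)) p n y u"
    unfolding answers_within_def by (intro exI[of _ s] exI[of _ t] conjI) auto
  then show "\<exists>k. answers_within k p n y u" ..
next
  assume "\<exists>k. answers_within k p n y u"
  then show "answers p n y u"
    unfolding answers_def answers_within_def computes_iff_run by blast
qed

lemma sets_answers_within: "{u. answers_within k p n y u} \<in> sets coin_measure"
  by (rule coin_finitely_determined(1)[OF answers_within_cong])

lemma sets_answers: "{u. answers p n y u} \<in> sets coin_measure"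
proof -
  have "{u. answers p n y u} = (\<Union>k. {u. answers_within k p n y u})"
    by (auto simp: answers_iff)
  then show ?thesis using sets_answers_within by simp
qed

lemma prob_answers_within:
  "coin.prob {u. answers_within k p n y u} =
    card {x. x < 2 ^ k \<and> answers_within k p n y (oracle_of x)} / 2 ^ k"
  by (rule coin_finitely_determined(2)[OF answers_within_cong])

lemma card_le_iff_prob:
  "card {x. x < 2 ^ k \<and> answers_within k p n y (oracle_of x)} * 2 ^ n \<le> 2 ^ k \<longleftrightarrow>
    coin.prob {u. answers_within k p n y u} \<le> 1 / 2 ^ n"
proof -
  have "c * 2 ^ n \<le> 2 ^ k \<longleftrightarrow> real c / 2 ^ k \<le> 1 / 2 ^ n" for c :: nat
  proof -
    have "c * 2 ^ n \<le> 2 ^ k \<longleftrightarrow> real c * 2 ^ n \<le> 2 ^ k"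
      using of_nat_le_iff[of "c * 2 ^ n" "2 ^ k", where 'a = real] by simp
    also have "\<dots> \<longleftrightarrow> real c / 2 ^ k \<le> 1 / 2 ^ n"
      by (simp add: field_simps)
    finally show ?thesis .
  qed
  then show ?thesis
    unfolding prob_answers_within .
qed

text \<open>The time-bounded events increase to \<open>answers\<close>, so the common bound passes
  to the limit by continuity from below.\<close>

lemma prob_answers_le:
  assumes "rarely_exceeded n y" "p \<le> n" shows "coin.prob {u. answers p n y u} \<le> 1 / 2 ^ n"
proof -
  let ?A = "\<lambda>k. {u. answers_within k p n y u}"
  have "(\<lambda>k. coin.prob (?A k)) \<longlonglongrightarrow> coin.prob (\<Union>k. ?A k)"
    using sets_answers_within answers_within_mono
    by (intro coin.finite_Lim_measure_incseq) (auto simp: incseq_def)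
  moreover have "coin.prob (?A k) \<le> 1 / 2 ^ n" for k
    using assms card_le_iff_prob unfolding rarely_exceeded_def by (simp add: less_Suc_eq_le)
  moreover have "(\<Union>k. ?A k) = {u. answers p n y u}" by (auto simp: answers_iff)
  ultimately show ?thesis by (intro LIMSEQ_le_const2) auto
qed

lemma rarely_exceeded_mono:
  assumes "rarely_exceeded n y" "y \<le> y'" shows "rarely_exceeded n y'"
  unfolding rarely_exceeded_def
proof (intro allI impI)
  fix p k assume "p < Suc n"
  have "card {x. x < 2 ^ k \<and> answers_within k p n y' (oracle_of x)} \<le>
      card {x. x < 2 ^ k \<and> answers_within k p n y (oracle_of x)}"
    using answers_within_antimono[OF _ assms(2)] by (intro card_mono) auto
  then have "card {x. x < 2 ^ k \<and> answers_within k p n y' (oracle_of x)} * 2 ^ n \<le>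
      card {x. x < 2 ^ k \<and> answers_within k p n y (oracle_of x)} * 2 ^ n"
    by simp
  also have "\<dots> \<le> 2 ^ k"
    using assms(1) \<open>p < Suc n\<close> unfolding rarely_exceeded_def by blast
  finally show "card {x. x < 2 ^ k \<and> answers_within k p n y' (oracle_of x)} * 2 ^ n \<le> 2 ^ k" .
qed

text \<open>For \<open>n = 0\<close> the bound is 1 and holds trivially. Hence any number is a
  correct witness in the base case of the induction.\<close>

lemma rarely_exceeded_0: "rarely_exceeded 0 y"
  unfolding rarely_exceeded_def
proof (intro allI impI)
  fix p k :: nat
  have "card {x. x < 2 ^ k \<and> answers_within k p 0 y (oracle_of x)} \<le> card {..<2 ^ k :: nat}"
    by (intro card_mono) auto
  then show "card {x. x < 2 ^ k \<and> answers_within k p 0 y (oracle_of x)} * 2 ^ 0 \<le> 2 ^ k" by simp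
qed

text \<open>For fixed \<open>p\<close> and \<open>u\<close> at most one witness is produced, so the
  events of exceeding \<open>y\<close> decrease to the empty set and their probabilities tend to 0.
  A maximum then serves the finitely many \<open>p \<le> n\<close>.\<close>

lemma rarely_exceeded_exists: "\<exists>y. rarely_exceeded n y"
proof -
  have "\<exists>y. coin.prob {u. answers p n y u} \<le> 1 / 2 ^ n" for p
  proof -
    let ?A = "\<lambda>y. {u. answers p n y u}"
    have empty: "(\<Inter>y. ?A y) = {}"
    proof (intro equals0I)
      fix u assume u: "u \<in> (\<Inter>y. ?A y)"
      then have "answers p n 0 u" by blast
      then obtain a m where am: "computes p u n a" "computes a u 1 m" unfolding answers_def by blast
      have "answers p n (Suc m) u" using u by blast
      then obtain b l where bl: "computes p u n b" "computes b u 1 l" "Suc m \<le> l"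
        unfolding answers_def by blast
      have "b = a" using computes_unique[OF bl(1) am(1)] .
      then have "l = m" using computes_unique[OF bl(2)] am(2) by blast
      then show False using bl(3) by simp
    qed
    have "decseq ?A"
      unfolding decseq_def answers_def using le_trans by blast
    then have "(\<lambda>y. coin.prob (?A y)) \<longlonglongrightarrow> coin.prob (\<Inter>y. ?A y)"
      using sets_answers by (intro coin.finite_Lim_measure_decseq) auto
    then have "(\<lambda>y. coin.prob (?A y)) \<longlonglongrightarrow> 0" unfolding empty by simp
    then have "eventually (\<lambda>y. coin.prob (?A y) < 1 / 2 ^ n) sequentially"
      by (rule order_tendstoD) simp
    then obtain y where "coin.prob (?A y) < 1 / 2 ^ n"
      using eventually_happens'[OF sequentially_bot] by blast
    then show ?thesis using less_imp_le by blast
  qed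
  then obtain Y where Y: "\<And>p. coin.prob {u. answers p n (Y p) u} \<le> 1 / 2 ^ n" by metis
  define y where "y = Max (Y ` {..n})"
  have "rarely_exceeded n y"
    unfolding rarely_exceeded_def card_le_iff_prob
  proof (intro allI impI)
    fix p k assume "p < Suc n"
    then have le: "Y p \<le> y" by (simp add: y_def less_Suc_eq_le)
    have "{u. answers_within k p n y u} \<subseteq> {u. answers p n (Y p) u}"
      unfolding answers_iff using answers_within_antimono[OF _ le] by blast
    then have "coin.prob {u. answers_within k p n y u} \<le> coin.prob {u. answers p n (Y p) u}"
      using sets_answers by (intro coin.finite_measure_mono)
    also note Y
    finally show "coin.prob {u. answers_within k p n y u} \<le> 1 / 2 ^ n" .
  qed
  then show ?thesis ..
qed


section \<open>The failure of induction\<close>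

definition write_table :: "nat \<Rightarrow> program" where
  "write_table c = concat (map (\<lambda>j. [((j, False, False), (Suc j, True, MoveRight, Stay)),
    ((j, True, False), (Suc j, True, MoveRight, Stay))]) [0..<c])"

text \<open>State 0 plays two roles: on a mark it erases the input, and on the first blank it starts
  writing. The state then counts the marks written. Each key is listed for both oracle bits, which
  makes the oracle irrelevant.\<close>

definition const_table :: "nat \<Rightarrow> program" where
  "const_table c = ((0, False, True), (0, False, MoveRight, Stay)) #
    ((0, True, True), (0, False, MoveRight, Stay)) # write_table c"

lemma map_of_write_table:
  "map_of (write_table c) (j, b, False) = (if j < c then Some (Suc j, True, MoveRight, Stay) else None)"
  by (induction c) (cases b; auto simp: write_table_def map_add_def less_Suc_eq)+

lemma map_of_const_table:
  "map_of (const_table c) (0, b, True) = Some (0, False, MoveRight, Stay)"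
  "map_of (const_table c) (j, b, False) = (if j < c then Some (Suc j, True, MoveRight, Stay) else None)"
  by (cases b; simp add: const_table_def map_of_write_table)+

lemma const_program_exists: "\<exists>p. \<forall>u n. computes p u n c"
proof -
  obtain p where p: "program_of p = const_table c" using surj_program_of by (metis surjD)
  have "computes p u n c" for u n
  proof -
    let ?R = "\<lambda>c d. step (program_of p) u c = Some d"
    have "?R\<^sup>*\<^sup>* (0, 0, l, replicate m True) (0, 0, replicate m False @ l, [])" for m l
    proof (induction m arbitrary: l)
      case (Suc m)
      have "?R (0, 0, l, replicate (Suc m) True) (0, 0, False # l, replicate m True)"
        by (simp add: p map_of_const_table)
      moreover have "?R\<^sup>*\<^sup>* (0, 0, False # l, replicate m True) (0, 0, replicate (Suc m) False @ l, [])"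
        using Suc[of "False # l"] by (simp add: replicate_app_Cons_same)
      ultimately show ?case by (rule converse_rtranclp_into_rtranclp)
    qed simp
    from this[of "[]" "Suc n"]
    have "?R\<^sup>*\<^sup>* (initial_config n) (0, 0, replicate (Suc n) False, [])"
      by (simp add: initial_config_def)
    moreover have "?R\<^sup>*\<^sup>* (0, 0, l, []) (j, 0, replicate j True @ l, [])" if "j \<le> c" for j l
      using that
    proof (induction j)
      case (Suc j)
      have "?R (j, 0, replicate j True @ l, []) (Suc j, 0, replicate (Suc j) True @ l, [])"
        using Suc.prems by (simp add: p map_of_const_table)
      with Suc show ?case by (auto intro: rtranclp.rtrancl_into_rtrancl)
    qed simp
    ultimately have "?R\<^sup>*\<^sup>* (initial_config n) (c, 0, replicate c True @ replicate (Suc n) False, [])"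
      using rtranclp_trans[of ?R] by blast
    moreover have "count_list (replicate m False) True = 0" for m
      by (induction m) auto
    ultimately show ?thesis
      unfolding computes_def
      by (intro exI[of _ "(c, 0, replicate c True @ replicate (Suc n) False, [])"])
        (simp add: p map_of_const_table count_list_replicate)
  qed
  then show ?thesis by blast
qed

text \<open>The hypothesis says that \<open>u\<close> starts with exactly \<open>y\<close> ones. The
  machine copies these ones to the tape and halts at the first zero, for which its table has no
  entry. Marks of the input beyond the overwritten part still count, hence only
  \<open>m \<ge> y\<close>.\<close>

lemma guessing_program_exists:
  "\<exists>p. \<forall>u n y. (\<forall>i<Suc y. u i = (i < y)) \<longrightarrow> (\<exists>m\<ge>y. computes p u n m)"
proof -
  obtain p where p: "program_of p =
      [((0, True, False), (0, True, MoveRight, MoveRight)), ((0, True, True), (0, True, MoveRight, MoveRight))]"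
    using surj_program_of by (metis surjD)
  have "\<exists>m\<ge>y. computes p u n m" if u: "\<forall>i<Suc y. u i = (i < y)" for u n y
  proof -
    let ?R = "\<lambda>c d. step (program_of p) u c = Some d"
    have "\<exists>r. ?R\<^sup>*\<^sup>* (initial_config n) (0, i, replicate i True, r)" if "i \<le> y" for i
      using that
    proof (induction i)
      case 0
      then show ?case by (auto simp: initial_config_def)
    next
      case (Suc i)
      then obtain r where r: "?R\<^sup>*\<^sup>* (initial_config n) (0, i, replicate i True, r)" by auto
      have "u i" using u Suc.prems by simp
      then have "?R (0, i, replicate i True, r) (0, Suc i, replicate (Suc i) True, tl r)"
        by (cases "scanned r") (simp_all add: p)
      with r show ?case by (blast intro: rtranclp.rtrancl_into_rtrancl)
    qed
    then obtain r where r: "?R\<^sup>*\<^sup>* (initial_config n) (0, y, replicate y True, r)" by auto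
    have "step (program_of p) u (0, y, replicate y True, r) = None"
      using u by (simp add: p)
    with r have "computes p u n (output_of (0, y, replicate y True, r))"
      unfolding computes_def by blast
    then show ?thesis by (intro exI conjI) (auto simp: count_list_replicate)
  qed
  then show ?thesis by blast
qed

section \<open>The realisability argument\<close>

lemma subst_term_Succ: "subst_term (subst_term t x (Succ (Var x))) x r = subst_term t x (Succ r)"
  by (induction t) auto

text \<open>This identifies the conclusion of the induction step, instantiated at \<open>n\<close>,
  with the formula at \<open>Suc n\<close>.\<close>

lemma subst_Succ: "subst (subst \<phi> x (Succ (Var x))) x r = subst \<phi> x (Succ r)"
  by (induction \<phi>) (auto simp: subst_term_Succ)

theorem theorem5:
  shows "\<exists>\<phi> x. free_vars \<phi> \<subseteq> {x} \<and> \<not> mu_realisable (induction_sentence x \<phi>)"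
proof -
  obtain \<psi> where \<psi>: "inert \<psi>" "free_vars \<psi> \<subseteq> {..<2}"
      "\<And>v. sat \<psi> v \<longleftrightarrow> rarely_exceeded (v 0) (v 1)"
    using arith_rel_rarely_exceeded unfolding arith_rel_def by blast
  define \<phi> where "\<phi> = Exists 1 \<psi>"
  define \<phi>n where "\<phi>n n = subst \<phi> 0 (numeral_term n)" for n
  \<comment> \<open>The matrix is inert, so the output \<open>a\<close> at 0 may be anything; only
    the witness \<open>m\<close> counts.\<close>
  have realises_iff: "O_realises (\<phi>n n) p u \<longleftrightarrow>
      (\<exists>a m. computes p u 0 a \<and> computes p u 1 m \<and> rarely_exceeded n m)" for n p u
  proof -
    have "O_realises (subst (subst \<psi> 0 (numeral_term n)) 1 (numeral_term m)) a u \<longleftrightarrow>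
        rarely_exceeded n m" for m a
      using \<psi>(1) by (simp add: O_realises_inert inert_subst sat_subst_numeral \<psi>(3))
    then show ?thesis by (simp add: \<phi>n_def \<phi>_def)
  qed
  have premise: "\<phi>n 0 = subst \<phi> 0 Zero" "\<phi>n (Suc n) = subst (subst \<phi> 0 (Succ (Var 0))) 0 (numeral_term n)" for n
    by (simp_all add: \<phi>n_def subst_Succ)

  obtain g where g: "\<And>u n y. \<forall>i<Suc y. u i = (i < y) \<Longrightarrow> \<exists>m\<ge>y. computes g u n m"
    using guessing_program_exists by blast
  have g_realises: "mu_realises (\<phi>n n) g" for n
  proof -
    obtain y where y: "rarely_exceeded n y" using rarely_exceeded_exists by blast
    have "O_realises (\<phi>n n) g u" if u: "\<forall>i<Suc y. u i = (i < y)" for u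
    proof -
      obtain a m where "computes g u 0 a" "computes g u 1 m" "y \<le> m" using g[OF u] by blast
      then show ?thesis using rarely_exceeded_mono[OF y] realises_iff by blast
    qed
    \<comment> \<open>The guess is right at least on the cylinder of \<open>y\<close> ones followed
      by a zero, and this already has positive probability.\<close>
    then have "coin.prob {u. \<forall>i<Suc y. u i = (i < y)} \<le> coin.prob {u. O_realises (\<phi>n n) g u}"
      using realisers_measurable by (intro coin.finite_measure_mono) auto
    then have "1 / 2 ^ Suc y \<le> coin.prob {u. O_realises (\<phi>n n) g u}"
      unfolding prob_coin_cylinder .
    then show ?thesis
      unfolding mu_realises.simps coin.emeasure_eq_measure
      by (intro exI[of _ "1 / 2 ^ Suc y"]) (simp add: ennreal_leI)
  qed

  text \<open>The outer realiser is constant, so the same \<open>e\<close> has to realise \<open>\<phi>(0)\<close> and the step.\<close>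
  obtain c where c: "\<And>u n. computes c u n g" using const_program_exists by blast
  obtain e where e: "\<And>u n. computes e u n c" using const_program_exists by blast
  obtain s where s: "\<And>u n. computes s u n e" using const_program_exists by blast
  let ?premise = "Conj (subst \<phi> 0 Zero) (Forall 0 (Impl \<phi> (subst \<phi> 0 (Succ (Var 0)))))"
  have "mu_realises ?premise s"
  proof (rule mu_realises_if_all)
    fix u
    \<comment> \<open>Here the output \<open>c\<close> of \<open>e\<close> at 1 is taken as a
      witness, which is correct like any other number.\<close>
    have "O_realises (\<phi>n 0) e u"
      using e realises_iff rarely_exceeded_0 by blast
    \<comment> \<open>The program \<open>c\<close> ignores the given realiser and returns
      \<open>g\<close>, which \<open>\<mu>\<close>-realises every instance.\<close>
    moreover have "O_realises (Impl (\<phi>n n) (\<phi>n (Suc n))) c u" for n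
      using c g_realises unfolding O_realises.simps by blast
    then have "O_realises (Forall 0 (Impl \<phi> (subst \<phi> 0 (Succ (Var 0))))) e u"
      using e unfolding O_realises.simps(7) subst.simps premise[symmetric] \<phi>n_def[symmetric] by blast
    ultimately show "O_realises ?premise s u"
      using s unfolding O_realises.simps(3) premise by blast
  qed

  moreover have "\<not> mu_realises (Forall 0 \<phi>) a" for a
  proof
    assume "mu_realises (Forall 0 \<phi>) a"
    then obtain r where r: "0 < r" "ennreal r \<le> emeasure coin_measure {u. O_realises (Forall 0 \<phi>) a u}"
      unfolding mu_realises.simps by blast
    obtain k where k: "(1/2) ^ k < r" using real_arch_pow_inv[OF r(1), of "1/2"] by auto
    \<comment> \<open>Being at least \<open>a\<close> puts the program \<open>a\<close> among those
      controlled at \<open>n\<close>; being at least \<open>k\<close> makes the bound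
      \<open>1 / 2 ^ n\<close> smaller than \<open>r\<close>.\<close>
    define n where "n = max a k"
    \<comment> \<open>Minimality makes every correct witness at least \<open>y\<close>, so success
      of \<open>a\<close> at \<open>n\<close> implies the rare event
      \<open>answers a n y\<close>.\<close>
    define y where "y = (LEAST y. rarely_exceeded n y)"
    have y: "rarely_exceeded n y"
      unfolding y_def using rarely_exceeded_exists by (rule LeastI_ex)
    have "answers a n y u" if all: "O_realises (Forall 0 \<phi>) a u" for u
    proof -
      obtain b where b: "computes a u n b" "O_realises (\<phi>n n) b u"
        using all unfolding O_realises.simps(7) \<phi>n_def by blast
      then obtain m where m: "computes b u 1 m" "rarely_exceeded n m" using realises_iff by blast
      then have "y \<le> m" unfolding y_def by (intro Least_le)
      then show ?thesis using b m unfolding answers_def by blast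
    qed
    then have "coin.prob {u. O_realises (Forall 0 \<phi>) a u} \<le> coin.prob {u. answers a n y u}"
      using sets_answers by (intro coin.finite_measure_mono) auto
    also have "\<dots> \<le> 1 / 2 ^ n"
      using y by (rule prob_answers_le) (simp add: n_def)
    also have "\<dots> \<le> (1/2) ^ k"
      unfolding power_one_over[symmetric] by (intro power_decreasing) (simp_all add: n_def)
    also note k
    finally show False
      using r unfolding coin.emeasure_eq_measure by (simp add: ennreal_le_iff del: O_realises.simps)
  qed

  ultimately have "\<not> O_realises (induction_sentence 0 \<phi>) p u" for p u
    unfolding induction_sentence_def O_realises.simps(5) by blast
  then have "{p. mu_realises (induction_sentence 0 \<phi>) p} = {}"
    using mu_realises_imp_O_realises by blast
  \<comment> \<open>The supremum over the empty set of realisers is 0 in the extended nonnegative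
    reals.\<close>
  then have "\<not> mu_realisable (induction_sentence 0 \<phi>)"
    unfolding mu_realisable_def by (simp only: image_empty Sup_empty bot_ennreal zero_neq_one not_False_eq_True)
  moreover have "free_vars \<phi> \<subseteq> {0}"
    using \<psi>(2) by (auto simp: \<phi>_def)
  ultimately show ?thesis by blast
qed

end
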